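(* Let $L,M,N,R\in\mathbb{N}$, let $p,q\in\mathbb{N}$ be coprime with $N/M=p/q$, let $\mathbb{S}\subset\mathbb{Z}$ be an $N\mathbb{Z}$-periodic set, and let $g=\{g_l\}_{l\in\mathbb{N}_L}\subset\ell^2(\mathbb{S},\mathbb{C}^R)$. The following statements are equivalent. (1) $\mathcal{G}(g,L,M,N,R)$ is complete in $\ell^2(\mathbb{S},\mathbb{C}^R)$. (2) For all $j\in\mathbb{N}_{M/q}$ and a.e. $\theta\in[0,1)$, $\operatorname{rank}(Z_g(j,\theta))=R\cdot\operatorname{card}(\mathcal{K}_j)$.
   Context: $\mathbb{N}=\{1,2,3,\dots\}$ and $\mathbb{N}_K=\{0,1,\dots,K-1\}$ for $K\in\mathbb{N}$. A nonempty set $\mathbb{S}\subset\mathbb{Z}$ is $N\mathbb{Z}$-periodic if $j+nN\in\mathbb{S}$ for all $j\in\mathbb{S}$, $n\in\mathbb{Z}$. $\ell^2(\mathbb{S})=\{f\in\ell^2(\mathbb{Z}): f(j)=0 \text{ if } j\notin\mathbb{S}\}$, and $\ell^2(\mathbb{S},\mathbb{C}^R)$ is the Hilbert space of $f=(f_1,\dots,f_R)$ with $f_r\in\ell^2(\mathbb{S})$ and inner product $\langle f,\tilde f\rangle=\sum_{r=1}^R\langle f_r,\tilde f_r\rangle$. Operators (componentwise): $E_{m/M}f(j)=e^{2\pi i mj/M}f(j)$, $T_{nN}f(j)=f(j-nN)$. The Gabor system is $\mathcal{G}(g,L,M,N,R)=\{E_{m/M}T_{nN}g_l\}_{m\in\mathbb{N}_M,\,n\in\mathbb{Z},\,l\in\mathbb{N}_L}$.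 A system in a Hilbert space is complete if its closed linear span is the whole space. Zak transform: for $K\in\mathbb{N}$, $h\in\ell^2(\mathbb{Z})$, $z_Kh(j,\theta)=\sum_{k\in\mathbb{Z}}h(j+kK)e^{2\pi i k\theta}$ for $j\in\mathbb{Z}$ and a.e. $\theta\in\mathbb{R}$ (convergence in $L^2([0,1))$ in $\theta$). For $h\in\ell^2(\mathbb{Z})$, $Z_h(j,\theta)$ is the $q\times p$ matrix with entries $Z_h(j,\theta)_{r,k}=z_{pM}h(j+kM-rN,\theta)$, $r\in\mathbb{N}_q$, $k\in\mathbb{N}_p$. For $f=(f_1,\dots,f_R)$, $Z_f(j,\theta)=(Z_{f_1}(j,\theta),\dots,Z_{f_R}(j,\theta))$ is the $q\times pR$ matrix obtained by placing the blocks side by side. For $g=\{g_l\}_{l\in\mathbb{N}_L}$, $Z_g(j,\theta)$ is the $qL\times pR$ matrix obtained by stacking $Z_{g_0}(j,\theta),\dots,Z_{g_{L-1}}(j,\theta)$ vertically. Finally $\mathcal{K}_j=\{k\in\mathbb{N}_p: j+kM\in\mathbb{S}\}$. *)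

theory Defs
  imports
    "HOL-Analysis.Analysis"
    "HOL-Library.Function_Algebras"
    "Jordan_Normal_Form.DL_Rank"
begin

text \<open>
  A vector-valued sequence \<open>f = (f\<^sub>1, \<dots>, f\<^sub>R)\<close> is a function \<open>f :: nat \<Rightarrow> int \<Rightarrow> complex\<close> whose
  components are numbered \<open>0, \<dots>, R - 1\<close>; members of \<open>ell2_vec S R\<close> vanish at all
  other component indices, so that equality of functions is equality in the space. Sums and
  differences of such functions are the pointwise ones.
\<close>

definition ell2 :: "int set \<Rightarrow> (int \<Rightarrow> complex) set" where
  "ell2 S = {f. (\<lambda>j. (cmod (f j))\<^sup>2) summable_on UNIV \<and> (\<forall>j. j \<notin> S \<longrightarrow> f j = 0)}"

definition ell2_inner :: "(int \<Rightarrow> complex) \<Rightarrow> (int \<Rightarrow> complex) \<Rightarrow> complex" where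
  "ell2_inner f h = (\<Sum>\<^sub>\<infinity>j. f j * cnj (h j))"

definition ell2_vec :: "int set \<Rightarrow> nat \<Rightarrow> (nat \<Rightarrow> int \<Rightarrow> complex) set" where
  "ell2_vec S R = {f. (\<forall>r<R. f r \<in> ell2 S) \<and> (\<forall>r\<ge>R. f r = 0)}"

definition ell2_vec_inner ::
    "nat \<Rightarrow> (nat \<Rightarrow> int \<Rightarrow> complex) \<Rightarrow> (nat \<Rightarrow> int \<Rightarrow> complex) \<Rightarrow> complex" where
  "ell2_vec_inner R f h = (\<Sum>r<R. ell2_inner (f r) (h r))"

definition ell2_vec_norm :: "nat \<Rightarrow> (nat \<Rightarrow> int \<Rightarrow> complex) \<Rightarrow> real" where
  "ell2_vec_norm R f = sqrt (Re (ell2_vec_inner R f f))"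

definition seq_scale :: "complex \<Rightarrow> (nat \<Rightarrow> int \<Rightarrow> complex) \<Rightarrow> nat \<Rightarrow> int \<Rightarrow> complex" where
  "seq_scale c f = (\<lambda>r j. c * f r j)"

global_interpretation seqs: vector_space seq_scale
  by unfold_locales (auto simp: seq_scale_def algebra_simps fun_eq_iff)

definition closed_span_in ::
    "int set \<Rightarrow> nat \<Rightarrow> (nat \<Rightarrow> int \<Rightarrow> complex) set \<Rightarrow> (nat \<Rightarrow> int \<Rightarrow> complex) set" where
  "closed_span_in S R X =
     {f \<in> ell2_vec S R. \<forall>\<epsilon>>0. \<exists>h \<in> seqs.span X. ell2_vec_norm R (f - h) < \<epsilon>}"

definition complete_system :: "int set \<Rightarrow> nat \<Rightarrow> (nat \<Rightarrow> int \<Rightarrow> complex) set \<Rightarrow> bool" where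
  "complete_system S R X \<longleftrightarrow> X \<subseteq> ell2_vec S R \<and> closed_span_in S R X = ell2_vec S R"

definition periodic_set :: "nat \<Rightarrow> int set \<Rightarrow> bool" where
  "periodic_set N S \<longleftrightarrow> S \<noteq> {} \<and> (\<forall>j\<in>S. \<forall>n. j + n * int N \<in> S)"

definition modulation :: "real \<Rightarrow> (nat \<Rightarrow> int \<Rightarrow> complex) \<Rightarrow> nat \<Rightarrow> int \<Rightarrow> complex" where
  "modulation a f = (\<lambda>r j. exp (2 * of_real pi * \<i> * of_real a * of_int j) * f r j)"

definition translation :: "int \<Rightarrow> (nat \<Rightarrow> int \<Rightarrow> complex) \<Rightarrow> nat \<Rightarrow> int \<Rightarrow> complex" where
  "translation k f = (\<lambda>r j. f r (j - k))"

definition gabor_system ::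
    "(nat \<Rightarrow> nat \<Rightarrow> int \<Rightarrow> complex) \<Rightarrow> nat \<Rightarrow> nat \<Rightarrow> nat \<Rightarrow> (nat \<Rightarrow> int \<Rightarrow> complex) set" where
  "gabor_system g L M N =
     {modulation (real m / real M) (translation (n * int N) (g l)) | m n l. m < M \<and> l < L}"

text \<open>
  The series defining \<open>z\<^sub>K h(j, \<cdot>)\<close> converges in \<open>L\<^sup>2([0,1))\<close>, so \<open>z\<^sub>K h(j, \<cdot>)\<close> is only determined
  up to null sets. \<open>is_zak K h j F\<close> says that \<open>F\<close> is a 1-periodic Borel representative;
  \<open>zak K h j\<close> is one such representative. The convergence is along the net of finite subsets of
  the integers, as for \<^const>\<open>has_sum\<close>, and the \<open>L\<^sup>2\<close> distance is a nonnegative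
  integral, so no integrability assumption on \<open>F\<close> is hidden in it.
\<close>

definition is_zak :: "nat \<Rightarrow> (int \<Rightarrow> complex) \<Rightarrow> int \<Rightarrow> (real \<Rightarrow> complex) \<Rightarrow> bool" where
  "is_zak K h j F \<longleftrightarrow>
     F \<in> borel_measurable borel \<and> (\<forall>\<theta>. F (\<theta> + 1) = F \<theta>) \<and>
     ((\<lambda>A. \<integral>\<^sup>+\<theta>\<in>{0..<1}. ennreal ((cmod (F \<theta> -
         (\<Sum>k\<in>A. h (j + k * int K) * exp (2 * of_real pi * \<i> * of_int k * of_real \<theta>))))\<^sup>2) \<partial>lborel)
       \<longlongrightarrow> 0) (finite_subsets_at_top UNIV)"

definition zak :: "nat \<Rightarrow> (int \<Rightarrow> complex) \<Rightarrow> int \<Rightarrow> real \<Rightarrow> complex" where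
  "zak K h j = (SOME F. is_zak K h j F)"

definition zak_matrix ::
    "nat \<Rightarrow> nat \<Rightarrow> nat \<Rightarrow> nat \<Rightarrow> (int \<Rightarrow> complex) \<Rightarrow> int \<Rightarrow> real \<Rightarrow> complex mat" where
  "zak_matrix M N p q h j \<theta> =
     mat q p (\<lambda>(r, k). zak (p * M) h (j + int k * int M - int r * int N) \<theta>)"

definition zak_matrix_vec ::
    "nat \<Rightarrow> nat \<Rightarrow> nat \<Rightarrow> nat \<Rightarrow> nat \<Rightarrow> (nat \<Rightarrow> int \<Rightarrow> complex) \<Rightarrow> int \<Rightarrow> real \<Rightarrow> complex mat" where
  "zak_matrix_vec M N p q R f j \<theta> =
     mat q (p * R) (\<lambda>(r, c). zak_matrix M N p q (f (c div p)) j \<theta> $$ (r, c mod p))"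

definition zak_matrix_sys ::
    "nat \<Rightarrow> nat \<Rightarrow> nat \<Rightarrow> nat \<Rightarrow> nat \<Rightarrow> nat \<Rightarrow> (nat \<Rightarrow> nat \<Rightarrow> int \<Rightarrow> complex) \<Rightarrow> int \<Rightarrow> real
      \<Rightarrow> complex mat" where
  "zak_matrix_sys L M N p q R g j \<theta> =
     mat (q * L) (p * R)
       (\<lambda>(i, c). zak_matrix_vec M N p q R (g (i div q)) j \<theta> $$ (i mod q, c))"

definition mat_rank :: "complex mat \<Rightarrow> nat" where
  "mat_rank A = vec_space.rank (dim_row A) A"

definition K_set :: "int set \<Rightarrow> nat \<Rightarrow> nat \<Rightarrow> int \<Rightarrow> nat set" where
  "K_set S M p j = {k. k < p \<and> j + int k * int M \<in> S}"

end

theory Submission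
  imports Defs
begin

text \<open>
  Write the matrix index of a column as a pair of a component \<open>r\<close> and \<open>k \<in> \<nat>\<^sub>p\<close>. The Zak transform maps the values of
  a vector \<open>f\<close> on \<open>j + M\<int>\<close> isometrically to a row of functions in \<open>L\<^sup>2([0,1))\<close>, and the system elements,
  restricted to \<open>j + M\<int>\<close>, to unimodular multiples of the rows of \<open>Z\<^sub>g(j, \<cdot>)\<close>. Columns with
  \<open>k \<notin> \<K>\<^sub>j\<close> vanish a.e., so the rank condition says that the kernel of \<open>Z\<^sub>g(j, \<theta>)\<close> is trivial on the
  remaining coordinates for a.e. \<open>\<theta>\<close>.

  If the system is complete, the unit vectors at the points of \<open>(j + M\<int>) \<inter> S\<close> are limits of elements
  of the span; along a fast subsequence their Zak transforms converge a.e., so the constant unit rows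
  are a.e. limits of elements of the row space, which is finite-dimensional and hence closed. No
  measurable selection is needed.

  Conversely, if \<open>w\<close> is orthogonal to the system, then Fourier inversion modulo \<open>M\<close> and the uniqueness
  of Fourier coefficients give \<open>Z\<^sub>g(j, \<theta>) (cnj W(\<theta>)) = 0\<close> a.e., where \<open>W\<close> is the Zak transform of \<open>w\<close>
  on \<open>j + M\<int>\<close>. Hence \<open>w = 0\<close> on \<open>j + M\<int>\<close>. The translates of \<open>w\<close> by \<open>N\<int>\<close> are orthogonal to the
  system as well, and \<open>M\<int> + N\<int> = (M/q)\<int>\<close>, so it suffices to treat \<open>j < M/q\<close>.
\<close>

section \<open>Matrix rank\<close>

text \<open>The shape of the matrix comes from \<open>q * N = p * M\<close>. A translation by
  \<open>n * N\<close> with \<open>n = t * q + r\<close> and \<open>r < q\<close> moves the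
  coefficients of a generator by \<open>t\<close> places and selects row \<open>r\<close>.
  Infinitely many translates therefore yield only \<open>q\<close> rows per generator, up to a
  character, and on a fixed residue class modulo \<open>M\<close> a modulation contributes only a
  scalar.

  A trivial kernel is tested, for fixed \<theta>, against all vectors at once. Linear algebra is
  thus applied pointwise, and the exceptional null sets come from finitely many entries and
  countably many approximants, never from individual vectors.

  The obstacle in the converse is that the entries of the matrix and the Zak transform of
  \<open>w\<close> are square-integrable, so their products are merely integrable. Parseval's
  identity computes the Fourier coefficients of these products but cannot recover the products from
  them. Uniqueness is therefore proved for integrable functions, by an argument separate from the
  Hilbert space theory.\<close>

unbundle no vec_syntax

context vec_space
begin

lemma lincomb_col_image_index:
  assumes A: "A \<in> carrier_mat n m" and C: "C \<subseteq> {..<m}" and inj: "inj_on (col A) C" and i: "i < n"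
  shows "lincomb a (col A ` C) $ i = (\<Sum>c\<in>C. A $$ (i, c) * a (col A c))"
proof -
  have "col A ` C \<subseteq> carrier_vec n"
    using A C by auto
  then have "lincomb a (col A ` C) $ i = (\<Sum>x\<in>col A ` C. a x * x $ i)"
    by (rule lincomb_index[OF i])
  also have "\<dots> = (\<Sum>c\<in>C. a (col A c) * col A c $ i)"
    by (rule sum.reindex_cong[OF inj]) auto
  also have "\<dots> = (\<Sum>c\<in>C. A $$ (i, c) * a (col A c))"
    using A C i by (intro sum.cong) auto
  finally show ?thesis .
qed

text \<open>Independence is a property of a set of vectors, in which equal columns are merged;
  injectivity of \<open>col A\<close> on \<open>C\<close> records that no merging occurs. If columns
  \<open>c\<close> and \<open>d\<close> coincide, the difference of the two unit coordinate vectors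
  lies in the kernel.\<close>

lemma lin_indpt_cols_iff:
  assumes A: "A \<in> carrier_mat n m" and C: "C \<subseteq> {..<m}"
  shows "inj_on (col A) C \<and> lin_indpt (col A ` C) \<longleftrightarrow>
    (\<forall>v. (\<forall>i<n. (\<Sum>c\<in>C. A $$ (i, c) * v c) = 0) \<longrightarrow> (\<forall>c\<in>C. v c = 0))" (is "?L \<longleftrightarrow> ?R")
proof
  have fin: "finite C" using C finite_subset by blast
  have sub: "col A ` C \<subseteq> carrier_vec n" using A C by auto
  show ?R if L: ?L
  proof (intro allI impI ballI)
    fix v c assume v: "\<forall>i<n. (\<Sum>c\<in>C. A $$ (i, c) * v c) = 0" and c: "c \<in> C"
    have inj: "inj_on (col A) C" using L by blast
    define a where "a = (\<lambda>x. v (the_inv_into C (col A) x))"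
    have a: "a (col A c) = v c" if "c \<in> C" for c
      using the_inv_into_f_f[OF inj that] by (simp add: a_def)
    have "lincomb a (col A ` C) = 0\<^sub>v n"
    proof (rule eq_vecI)
      show "dim_vec (lincomb a (col A ` C)) = dim_vec (0\<^sub>v n :: 'a vec)"
        using lincomb_dim[OF _ sub] fin by simp
      show "lincomb a (col A ` C) $ i = 0\<^sub>v n $ i" if "i < dim_vec (0\<^sub>v n :: 'a vec)" for i
        using that v a by (simp add: lincomb_col_image_index[OF A C inj])
    qed
    then show "v c = 0"
      using L c lin_dep_crit[where S = "col A ` C" and A = "col A ` C" and a = a and v = "col A c"] fin a
      by fastforce
  qed
  show ?L if R: ?R
  proof
    show inj: "inj_on (col A) C"
    proof (rule inj_onI, rule ccontr)
      fix c d assume cd: "c \<in> C" "d \<in> C" "col A c = col A d" "c \<noteq> d"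
      define v where "v = (\<lambda>x. if x = c then 1 else if x = d then -1 else 0 :: 'a)"
      have "(\<Sum>x\<in>C. A $$ (i, x) * v x) = 0" if i: "i < n" for i
      proof -
        have "(\<Sum>x\<in>C. A $$ (i, x) * v x) = (\<Sum>x\<in>{c, d}. A $$ (i, x) * v x)"
          using cd fin by (intro sum.mono_neutral_right) (auto simp: v_def)
        also have "\<dots> = A $$ (i, c) - A $$ (i, d)"
          using cd by (simp add: v_def)
        also have "\<dots> = 0"
          using arg_cong[OF cd(3), of "\<lambda>x. x $ i"] subsetD[OF C cd(1)] subsetD[OF C cd(2)] A i
          by simp
        finally show ?thesis .
      qed
      then have "v c = 0" using R cd by blast
      then show False by (simp add: v_def)
    qed
    show "lin_indpt (col A ` C)"
    proof
      assume "lin_dep (col A ` C)"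
      then obtain a w where a: "lincomb a (col A ` C) = 0\<^sub>v n" "w \<in> col A ` C" "a w \<noteq> 0"
        using finite_lin_dep[of "col A ` C"] fin sub by auto
      have "\<forall>i<n. (\<Sum>c\<in>C. A $$ (i, c) * a (col A c)) = 0"
        using a(1) by (simp flip: lincomb_col_image_index[OF A C inj])
      then have "\<forall>c\<in>C. a (col A c) = 0"
        by (rule R[THEN spec[of _ "\<lambda>c. a (col A c)"], THEN mp])
      then show False using a by auto
    qed
  qed
qed

text \<open>The rank is the size of a maximal independent set of columns. No independent set
  contains the zero vector, so each one lies in the image of \<open>C\<close>. The size
  \<open>card C\<close> is reached only if this image is itself independent and no two columns
  indexed by \<open>C\<close> coincide.\<close>

lemma rank_eq_card_iff:
  assumes A: "A \<in> carrier_mat n m" and C: "C \<subseteq> {..<m}"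
    and zero: "\<And>i c. i < n \<Longrightarrow> c < m \<Longrightarrow> c \<notin> C \<Longrightarrow> A $$ (i, c) = 0"
  shows "rank A = card C \<longleftrightarrow>
    (\<forall>v. (\<forall>i<n. (\<Sum>c\<in>C. A $$ (i, c) * v c) = 0) \<longrightarrow> (\<forall>c\<in>C. v c = 0))"
    (is "_ \<longleftrightarrow> ?R")
proof -
  have fin: "finite C" using C finite_subset by blast
  have cols: "set (cols A) = col A ` {..<m}"
    using A by (auto simp: cols_def)
  have zero': "col A c = 0\<^sub>v n" if "c < m" "c \<notin> C" for c
    using A that zero by (intro eq_vecI) auto
  have nz: "0\<^sub>v n \<notin> T" if "lin_indpt T" for T
  proof -
    have "(UNIV :: 'a set) \<noteq> {0}"
      by (metis UNIV_I one_neq_zero singletonD)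
    then show ?thesis using that zero_lin_dep[of T] by auto
  qed
  have le: "T \<subseteq> col A ` C" if T: "T \<subseteq> set (cols A)" "lin_indpt T" for T
  proof
    fix x assume "x \<in> T"
    moreover from this obtain c where "c < m" "x = col A c"
      using T(1) cols by auto
    moreover have "x \<noteq> 0\<^sub>v n"
      using nz[OF T(2)] \<open>x \<in> T\<close> by auto
    ultimately show "x \<in> col A ` C" using zero' by auto
  qed
  have "rank A = card C \<longleftrightarrow> inj_on (col A) C \<and> lin_indpt (col A ` C)"
  proof
    assume r: "rank A = card C"
    obtain T where T: "maximal T (\<lambda>T. T \<subseteq> set (cols A) \<and> lin_indpt T)"
      using maximal_exists[of "(\<lambda>T. T \<subseteq> set (cols A) \<and> lin_indpt T)" "card (set (cols A))" "{}"]
      by (meson List.finite_set card_mono empty_iff empty_subsetI finite_lin_indpt2 rev_finite_subset)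
    then have T': "T \<subseteq> set (cols A)" "lin_indpt T" by (auto simp: maximal_def)
    have cT: "card T = card C" using rank_card_indpt[OF A T] r by simp
    have "card (col A ` C) \<le> card C" by (rule card_image_le[OF fin])
    \<comment> \<open>\<open>T\<close> has \<open>card C\<close> elements and the image of
      \<open>C\<close> has at most that many, so the inclusion is an equality, and the equal
      cardinalities give injectivity.\<close>
    moreover have "T \<subseteq> col A ` C" using le T' by blast
    ultimately have "T = col A ` C" using fin cT by (metis card_seteq finite_imageI)
    then show "inj_on (col A) C \<and> lin_indpt (col A ` C)"
      using T' cT fin eq_card_imp_inj_on by metis
  next
    assume L: "inj_on (col A) C \<and> lin_indpt (col A ` C)"
    have "maximal (col A ` C) (\<lambda>T. T \<subseteq> set (cols A) \<and> lin_indpt T)"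
      unfolding maximal_def using L le C cols by (auto simp: image_mono)
    from rank_card_indpt[OF A this] show "rank A = card C"
      using L by (simp add: card_image)
  qed
  then show ?thesis using lin_indpt_cols_iff[OF A C] by simp
qed

end

lemma mat_rank_eq_card_iff:
  fixes A :: "complex mat"
  assumes "A \<in> carrier_mat n m" and "C \<subseteq> {..<m}"
    and "\<And>i c. i < n \<Longrightarrow> c < m \<Longrightarrow> c \<notin> C \<Longrightarrow> A $$ (i, c) = 0"
  shows "mat_rank A = card C \<longleftrightarrow>
    (\<forall>v. (\<forall>i<n. (\<Sum>c\<in>C. A $$ (i, c) * v c) = 0) \<longrightarrow> (\<forall>c\<in>C. v c = 0))"
  using vec_space.rank_eq_card_iff[OF assms] assms(1) by (simp add: mat_rank_def)

section \<open>Square-summable families\<close>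

text \<open>The index type is left open because the same Hilbert space facts are applied to
  sequences on \<open>int\<close> and to uncurried vectors on
  \<open>nat \<times> int\<close>.\<close>

definition square_summable :: "('i \<Rightarrow> complex) \<Rightarrow> bool" where
  "square_summable f \<longleftrightarrow> (\<lambda>x. (cmod (f x))\<^sup>2) summable_on UNIV"

definition sqnorm :: "('i \<Rightarrow> complex) \<Rightarrow> real" where
  "sqnorm f = (\<Sum>\<^sub>\<infinity>x. (cmod (f x))\<^sup>2)"

definition inprod :: "('i \<Rightarrow> complex) \<Rightarrow> ('i \<Rightarrow> complex) \<Rightarrow> complex" where
  "inprod f g = (\<Sum>\<^sub>\<infinity>x. f x * cnj (g x))"

lemma cmod_add_sq_le: "(cmod (a + b))\<^sup>2 \<le> 2 * (cmod a)\<^sup>2 + 2 * (cmod b)\<^sup>2"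
proof -
  have "(cmod (a + b))\<^sup>2 \<le> (cmod a + cmod b)\<^sup>2"
    by (intro power_mono norm_triangle_ineq) auto
  also have "\<dots> \<le> 2 * (cmod a)\<^sup>2 + 2 * (cmod b)\<^sup>2"
    using sum_squares_bound[of "cmod a" "cmod b"] by (simp add: power2_sum)
  finally show ?thesis .
qed

lemma cmod_diff_sq_le: "(cmod (a - b))\<^sup>2 \<le> 2 * (cmod a)\<^sup>2 + 2 * (cmod b)\<^sup>2"
  using cmod_add_sq_le[of a "- b"] by simp

lemma cmod_mult_le_sq: "cmod (a * cnj b) \<le> (cmod a)\<^sup>2 + (cmod b)\<^sup>2"
proof -
  have "2 * (cmod a * cmod b) \<le> (cmod a)\<^sup>2 + (cmod b)\<^sup>2"
    using sum_squares_bound[of "cmod a" "cmod b"] by simp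
  moreover have "0 \<le> cmod a * cmod b" by simp
  ultimately have "cmod a * cmod b \<le> (cmod a)\<^sup>2 + (cmod b)\<^sup>2" by linarith
  then show ?thesis by (simp add: norm_mult)
qed

lemma square_summable_prod:
  assumes "square_summable f" "square_summable g"
  shows "(\<lambda>x. f x * cnj (g x)) summable_on UNIV"
proof -
  have "(\<lambda>x. (cmod (f x))\<^sup>2 + (cmod (g x))\<^sup>2) summable_on UNIV"
    using assms by (auto simp: square_summable_def intro: summable_on_add)
  then have "(\<lambda>x. cmod (f x * cnj (g x))) summable_on UNIV"
    by (rule summable_on_comparison_test) (auto intro: cmod_mult_le_sq)
  then show ?thesis by (rule abs_summable_summable)
qed

lemma square_summable_add:
  assumes "square_summable f" "square_summable g"
  shows "square_summable (\<lambda>x. f x + g x)"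
proof -
  have "(\<lambda>x. 2 * (cmod (f x))\<^sup>2 + 2 * (cmod (g x))\<^sup>2) summable_on UNIV"
    using assms by (auto simp: square_summable_def intro: summable_on_add summable_on_cmult_right)
  then show ?thesis
    unfolding square_summable_def
    by (rule summable_on_comparison_test) (auto intro: cmod_add_sq_le)
qed

lemma square_summable_scale:
  "square_summable f \<Longrightarrow> square_summable (\<lambda>x. c * f x)"
  by (auto simp: square_summable_def norm_mult power_mult_distrib intro: summable_on_cmult_right)

lemma square_summable_diff:
  "square_summable f \<Longrightarrow> square_summable g \<Longrightarrow> square_summable (\<lambda>x. f x - g x)"
  using square_summable_add[of f "\<lambda>x. - 1 * g x"] square_summable_scale[of g "- 1"] by simp

lemma square_summable_zero [simp]: "square_summable (\<lambda>x. 0)"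
  by (simp add: square_summable_def)

lemma sqnorm_nonneg [simp]: "0 \<le> sqnorm f"
  by (auto simp: sqnorm_def intro: infsum_nonneg)

lemma sum_le_sqnorm:
  "square_summable f \<Longrightarrow> finite A \<Longrightarrow> (\<Sum>x\<in>A. (cmod (f x))\<^sup>2) \<le> sqnorm f"
  unfolding sqnorm_def square_summable_def by (rule finite_sum_le_infsum) auto

lemma coord_le_sqnorm: "square_summable f \<Longrightarrow> (cmod (f x))\<^sup>2 \<le> sqnorm f"
  using sum_le_sqnorm[of f "{x}"] by simp

lemma square_summableI:
  assumes "\<And>A. finite A \<Longrightarrow> (\<Sum>x\<in>A. (cmod (f x))\<^sup>2) \<le> B"
  shows "square_summable f" and "sqnorm f \<le> B"
proof -
  show s: "square_summable f"
    unfolding square_summable_def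
    by (rule nonneg_bdd_above_summable_on) (auto intro!: bdd_aboveI[of _ B] assms)
  show "sqnorm f \<le> B"
    using s unfolding square_summable_def sqnorm_def
    by (rule infsum_le_finite_sums) (rule assms)
qed

text \<open>As a quadratic polynomial in \<open>t\<close>, this expansion is the common source of
  the Cauchy-Schwarz inequality, the parallelogram law and polarization.\<close>

lemma sqnorm_diff_scale:
  assumes w: "square_summable w" and y: "square_summable y"
  shows "sqnorm (\<lambda>x. w x - t * y x) = sqnorm w - 2 * Re (cnj t * inprod w y) + (cmod t)\<^sup>2 * sqnorm y"
proof -
  have pt: "(cmod (a - t * b))\<^sup>2 = (cmod a)\<^sup>2 + (- 2) * Re (cnj t * (a * cnj b)) + (cmod t)\<^sup>2 * (cmod b)\<^sup>2"
    for a b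
    by (simp add: cmod_power2) (simp add: power2_eq_square algebra_simps)
  have s: "(\<lambda>x. cnj t * (w x * cnj (y x))) summable_on UNIV"
    using square_summable_prod[OF w y] by (rule summable_on_cmult_right)
  have "((\<lambda>x. (cmod (w x - t * y x))\<^sup>2) has_sum
      (sqnorm w + (- 2) * Re (cnj t * inprod w y) + (cmod t)\<^sup>2 * sqnorm y)) UNIV"
    unfolding pt sqnorm_def inprod_def
  proof (intro has_sum_add has_sum_cmult_right)
    show "((\<lambda>x. (cmod (w x))\<^sup>2) has_sum (\<Sum>\<^sub>\<infinity>x. (cmod (w x))\<^sup>2)) UNIV"
      using w by (simp add: square_summable_def)
    show "((\<lambda>x. (cmod (y x))\<^sup>2) has_sum (\<Sum>\<^sub>\<infinity>x. (cmod (y x))\<^sup>2)) UNIV"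
      using y by (simp add: square_summable_def)
    show "((\<lambda>x. Re (cnj t * (w x * cnj (y x)))) has_sum Re (cnj t * (\<Sum>\<^sub>\<infinity>x. w x * cnj (y x)))) UNIV"
      using square_summable_prod[OF w y] by (intro has_sum_Re has_sum_cmult_right) simp
  qed
  then show ?thesis by (simp add: sqnorm_def infsumI)
qed

text \<open>Restrict the quadratic polynomial to \<open>t = s * inprod w y\<close> with real
  \<open>s\<close> and optimize over \<open>s\<close>. The parameter \<open>d\<close> lets one
  argument serve twice: \<open>d = 0\<close> is Cauchy-Schwarz, and taking for \<open>d\<close> the
  squared distance to a subspace shows that a near-minimizer is nearly orthogonal to the
  subspace.\<close>

lemma inprod_bound:
  assumes w: "square_summable w" and y: "square_summable y"
    and d: "\<And>t. d \<le> sqnorm (\<lambda>x. w x - t * y x)"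
  shows "(cmod (inprod w y))\<^sup>2 \<le> (sqnorm w - d) * sqnorm y"
proof -
  define a where "a = inprod w y"
  have *: "(cmod a)\<^sup>2 * (2 * s - s\<^sup>2 * sqnorm y) \<le> sqnorm w - d" for s :: real
  proof -
    have "Re (cnj (of_real s * a) * a) = s * (cmod a)\<^sup>2"
      by (simp add: cmod_power2) (simp add: power2_eq_square algebra_simps)
    moreover have "(cmod (of_real s * a))\<^sup>2 = s\<^sup>2 * (cmod a)\<^sup>2"
      by (simp add: norm_mult power_mult_distrib)
    ultimately show ?thesis
      using d[of "of_real s * a"] unfolding sqnorm_diff_scale[OF w y] a_def[symmetric]
      by (simp add: algebra_simps)
  qed
  show ?thesis
  proof (cases "sqnorm y = 0")
    case True
    have "a = 0"
    proof (rule ccontr)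
      assume "a \<noteq> 0"
      then have p: "(cmod a)\<^sup>2 > 0" by simp
      \<comment> \<open>With \<open>sqnorm y = 0\<close> the bound is linear in \<open>s\<close>;
        this \<open>s\<close> makes the left side equal to the right side plus one.\<close>
      show False
        using *[of "(sqnorm w - d + 1) / (2 * (cmod a)\<^sup>2)"] p True by (simp add: field_simps)
    qed
    then show ?thesis using True by (simp add: a_def)
  next
    case False
    then have p: "sqnorm y > 0" using sqnorm_nonneg[of y] by linarith
    \<comment> \<open>The point \<open>1 / sqnorm y\<close> is the vertex of the concave parabola in
      \<open>s\<close>.\<close>
    have "2 * (1 / sqnorm y) - (1 / sqnorm y)\<^sup>2 * sqnorm y = 1 / sqnorm y"
      using p by (simp add: power2_eq_square field_simps)
    then show ?thesis
      using *[of "1 / sqnorm y"] p by (simp add: a_def pos_divide_le_eq)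
  qed
qed

lemma inprod_Cauchy_Schwarz:
  assumes "square_summable w" "square_summable y"
  shows "(cmod (inprod w y))\<^sup>2 \<le> sqnorm w * sqnorm y"
  using inprod_bound[OF assms, of 0] by simp

lemma inprod_diff_left:
  assumes "square_summable f" "square_summable g" "square_summable h"
  shows "inprod (\<lambda>x. f x - g x) h = inprod f h - inprod g h"
  using infsum_add[OF square_summable_prod[OF assms(1,3)]
      summable_on_uminus[THEN iffD2, OF square_summable_prod[OF assms(2,3)]]]
  by (simp add: inprod_def left_diff_distrib infsum_uminus)

lemma sqnorm_parallelogram:
  assumes "square_summable f" "square_summable g"
  shows "sqnorm (\<lambda>x. f x - g x) + sqnorm (\<lambda>x. f x + g x) = 2 * sqnorm f + 2 * sqnorm g"
  using sqnorm_diff_scale[OF assms, of 1] sqnorm_diff_scale[OF assms, of "- 1"] by simp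

text \<open>Each coordinate is controlled by the norm, so the sequence converges coordinatewise. The
  Cauchy bound survives in the limit because it is tested on finite index sets, where the limit may
  be taken term by term.\<close>

lemma square_summable_complete:
  fixes w :: "nat \<Rightarrow> 'i \<Rightarrow> complex"
  assumes w: "\<And>n. square_summable (w n)"
    and Cauchy: "\<And>e. e > 0 \<Longrightarrow> \<exists>N. \<forall>m\<ge>N. \<forall>n\<ge>N. sqnorm (\<lambda>x. w m x - w n x) \<le> e"
  obtains l where "square_summable l" "\<And>x. (\<lambda>n. w n x) \<longlonglongrightarrow> l x"
    "(\<lambda>n. sqnorm (\<lambda>x. w n x - l x)) \<longlonglongrightarrow> 0"
proof -
  have "Cauchy (\<lambda>n. w n x)" for x
  proof (rule CauchyI)
    fix e :: real assume e: "e > 0"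
    obtain N where N: "sqnorm (\<lambda>x. w m x - w n x) \<le> (e/2)\<^sup>2" if "m \<ge> N" "n \<ge> N" for m n
      using Cauchy[of "(e/2)\<^sup>2"] e by auto
    have "norm (w m x - w n x) < e" if "m \<ge> N" "n \<ge> N" for m n
    proof -
      have "(norm (w m x - w n x))\<^sup>2 \<le> (e/2)\<^sup>2"
        using coord_le_sqnorm[OF square_summable_diff[OF w[of m] w[of n]], of x] N[OF that] by linarith
      then have "norm (w m x - w n x) \<le> e/2"
        using e by (simp add: power2_le_iff_abs_le)
      then show ?thesis using e by simp
    qed
    then show "\<exists>M. \<forall>m\<ge>M. \<forall>n\<ge>M. norm (w m x - w n x) < e" by blast
  qed
  then have "\<forall>x. \<exists>l. (\<lambda>n. w n x) \<longlonglongrightarrow> l"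
    by (simp add: Cauchy_convergent_iff convergent_def)
  then obtain l where l: "\<And>x. (\<lambda>n. w n x) \<longlonglongrightarrow> l x" by metis
  have bound: "\<exists>N. \<forall>n\<ge>N. square_summable (\<lambda>x. w n x - l x) \<and> sqnorm (\<lambda>x. w n x - l x) \<le> e"
    if "e > 0" for e
  proof -
    obtain N where N: "sqnorm (\<lambda>x. w m x - w n x) \<le> e" if "m \<ge> N" "n \<ge> N" for m n
      using Cauchy[OF \<open>e > 0\<close>] by blast
    have "(\<Sum>x\<in>A. (cmod (w n x - l x))\<^sup>2) \<le> e" if n: "n \<ge> N" and A: "finite A" for n A
    proof (rule tendsto_upperbound)
      show "(\<lambda>m. \<Sum>x\<in>A. (cmod (w n x - w m x))\<^sup>2) \<longlonglongrightarrow> (\<Sum>x\<in>A. (cmod (w n x - l x))\<^sup>2)"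
        by (intro tendsto_intros l)
      show "\<forall>\<^sub>F m in sequentially. (\<Sum>x\<in>A. (cmod (w n x - w m x))\<^sup>2) \<le> e"
        using eventually_ge_at_top[of N]
      proof eventually_elim
        case (elim m)
        show ?case
          using sum_le_sqnorm[OF square_summable_diff[OF w[of n] w[of m]] A] N[OF n elim] by linarith
      qed
    qed simp
    then have "\<forall>n\<ge>N. square_summable (\<lambda>x. w n x - l x) \<and> sqnorm (\<lambda>x. w n x - l x) \<le> e"
      by (intro allI impI conjI square_summableI)
    then show ?thesis by blast
  qed
  obtain N where "square_summable (\<lambda>x. w N x - l x)"
    using bound[of 1] by auto
  then have "square_summable l"
    using square_summable_diff[OF w[of N], of "\<lambda>x. w N x - l x"] by simp
  moreover have "(\<lambda>n. sqnorm (\<lambda>x. w n x - l x)) \<longlonglongrightarrow> 0"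
  proof (rule LIMSEQ_I)
    fix e :: real assume "e > 0"
    then obtain N where "\<forall>n\<ge>N. sqnorm (\<lambda>x. w n x - l x) \<le> e / 2"
      using bound[of "e / 2"] by auto
    then show "\<exists>N. \<forall>n\<ge>N. norm (sqnorm (\<lambda>x. w n x - l x) - 0) < e"
      using \<open>e > 0\<close> by (intro exI[of _ N]) fastforce
  qed
  ultimately show thesis using l that by blast
qed

text \<open>The component of \<open>f\<close> orthogonal to \<open>V\<close>, as the limit of \<open>f - h n\<close> for a minimizing sequence.\<close>

lemma orthogonal_component:
  fixes f :: "'i \<Rightarrow> complex"
  assumes f: "square_summable f" and V: "\<And>h. h \<in> V \<Longrightarrow> square_summable h"
    and ne: "V \<noteq> {}"
    and add: "\<And>h k. h \<in> V \<Longrightarrow> k \<in> V \<Longrightarrow> (\<lambda>x. h x + k x) \<in> V"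
    and scale: "\<And>c h. h \<in> V \<Longrightarrow> (\<lambda>x. c * h x) \<in> V"
  obtains h w where "\<And>n. h n \<in> V" "square_summable w" "\<And>x. (\<lambda>n. f x - h n x) \<longlonglongrightarrow> w x"
    "(\<lambda>n. sqnorm (\<lambda>x. f x - h n x - w x)) \<longlonglongrightarrow> 0" "\<And>y. y \<in> V \<Longrightarrow> inprod w y = 0"
proof -
  define d where "d = (INF h\<in>V. sqnorm (\<lambda>x. f x - h x))"
  have bdd: "bdd_below ((\<lambda>h. sqnorm (\<lambda>x. f x - h x)) ` V)"
    by (rule bdd_belowI2[of _ 0]) simp
  have d_le: "d \<le> sqnorm (\<lambda>x. f x - h x)" if "h \<in> V" for h
    unfolding d_def using bdd that by (rule cINF_lower)
  have "\<exists>h\<in>V. sqnorm (\<lambda>x. f x - h x) < d + inverse (real (Suc n))" for n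
    using cINF_less_iff[OF ne bdd, of "d + inverse (real (Suc n))"] by (simp add: d_def)
  then obtain h where h: "\<And>n. h n \<in> V"
    and less: "\<And>n. sqnorm (\<lambda>x. f x - h n x) < d + inverse (real (Suc n))"
    by metis
  define w where "w = (\<lambda>n x. f x - h n x)"
  have w: "square_summable (w n)" for n
    unfolding w_def by (intro square_summable_diff f V h)
  have diff: "sqnorm (\<lambda>x. w m x - w n x) \<le> 2 * inverse (real (Suc m)) + 2 * inverse (real (Suc n))"
    for m n
  proof -
    \<comment> \<open>The midpoint of two near-minimizers cannot be closer to \<open>f\<close> than
      the infimum \<open>d\<close>; by the parallelogram law this forces the two to be close to each
      other.\<close>
    have "(\<lambda>x. 1 / 2 * (h m x + h n x)) \<in> V"
      by (intro scale add h)
    from d_le[OF this] have "4 * d \<le> 4 * sqnorm (\<lambda>x. f x - 1 / 2 * (h m x + h n x))" by simp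
    also have "\<dots> = sqnorm (\<lambda>x. 2 * (f x - 1 / 2 * (h m x + h n x)))"
      unfolding sqnorm_def norm_mult power_mult_distrib by (simp add: infsum_cmult_right')
    also have "\<dots> = sqnorm (\<lambda>x. w m x + w n x)"
      by (simp add: w_def algebra_simps)
    finally show ?thesis
      using sqnorm_parallelogram[OF w w, of m n] less[of m] less[of n]
      unfolding w_def by linarith
  qed
  have lim0: "(\<lambda>n. inverse (real (Suc n))) \<longlonglongrightarrow> 0"
    by (rule LIMSEQ_inverse_real_of_nat)
  have "\<exists>N. \<forall>m\<ge>N. \<forall>n\<ge>N. sqnorm (\<lambda>x. w m x - w n x) \<le> e" if "e > 0" for e
  proof -
    have "\<forall>\<^sub>F n in sequentially. inverse (real (Suc n)) < e / 4"
      using order_tendstoD(2)[OF lim0, of "e / 4"] that by simp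
    then obtain N where N: "\<And>n. n \<ge> N \<Longrightarrow> inverse (real (Suc n)) < e / 4"
      unfolding eventually_sequentially by blast
    have "sqnorm (\<lambda>x. w m x - w n x) \<le> e" if "m \<ge> N" "n \<ge> N" for m n
      using diff[of m n] N[OF that(1)] N[OF that(2)] by linarith
    then show ?thesis by blast
  qed
  from square_summable_complete[OF w this] obtain l where l: "square_summable l"
    "\<And>x. (\<lambda>n. w n x) \<longlonglongrightarrow> l x" "(\<lambda>n. sqnorm (\<lambda>x. w n x - l x)) \<longlonglongrightarrow> 0"
    by blast
  have "inprod l y = 0" if y: "y \<in> V" for y
  proof -
    have ys: "square_summable y" by (rule V[OF y])
    have 1: "(cmod (inprod (w n) y))\<^sup>2 \<le> inverse (real (Suc n)) * sqnorm y" for n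
    proof -
      \<comment> \<open>Subtracting \<open>t * y\<close> from \<open>f - h n\<close> gives the
        difference of \<open>f\<close> and another element of \<open>V\<close>, so \<open>d\<close>
        is a lower bound for every \<open>t\<close>.\<close>
      have "d \<le> sqnorm (\<lambda>x. w n x - t * y x)" for t
        using d_le[OF add[OF h scale[OF y]], of n t] by (simp add: w_def algebra_simps)
      from inprod_bound[OF w ys this]
      have "(cmod (inprod (w n) y))\<^sup>2 \<le> (sqnorm (w n) - d) * sqnorm y" .
      also have "\<dots> \<le> inverse (real (Suc n)) * sqnorm y"
        using less[of n] unfolding w_def by (intro mult_right_mono) auto
      finally show ?thesis .
    qed
    have 2: "(cmod (inprod (w n) y - inprod l y))\<^sup>2 \<le> sqnorm (\<lambda>x. w n x - l x) * sqnorm y" for n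
      using inprod_Cauchy_Schwarz[OF square_summable_diff[OF w l(1)] ys]
      by (simp add: inprod_diff_left w l(1) ys)
    have "(cmod (inprod l y))\<^sup>2 \<le> 2 * (inverse (real (Suc n)) * sqnorm y)
        + 2 * (sqnorm (\<lambda>x. w n x - l x) * sqnorm y)" for n
      using cmod_diff_sq_le[of "inprod (w n) y" "inprod (w n) y - inprod l y"] 1[of n] 2[of n] by simp
    moreover have "(\<lambda>n. 2 * (inverse (real (Suc n)) * sqnorm y)
        + 2 * (sqnorm (\<lambda>x. w n x - l x) * sqnorm y)) \<longlonglongrightarrow> 2 * (0 * sqnorm y) + 2 * (0 * sqnorm y)"
      by (intro tendsto_intros lim0 l(3))
    ultimately have "(cmod (inprod l y))\<^sup>2 \<le> 2 * (0 * sqnorm y) + 2 * (0 * sqnorm y)"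
      by (intro LIMSEQ_le_const) auto
    then show ?thesis by simp
  qed
  then show thesis
    using that[of h l] h l unfolding w_def by blast
qed

section \<open>Completeness of the space of square-integrable functions\<close>

text \<open>The squared norm takes values in \<open>ennreal\<close>, so estimates can be made before
  finiteness is known.\<close>

definition sqint :: "'a measure \<Rightarrow> ('a \<Rightarrow> complex) \<Rightarrow> ennreal" where
  "sqint M F = (\<integral>\<^sup>+x. ennreal ((cmod (F x))\<^sup>2) \<partial>M)"

text \<open>Sum and integral may be exchanged, and the geometric bound makes the integral of the sum
  finite, hence the sum finite almost everywhere. This is the only passage from norm convergence to
  pointwise convergence: it serves the Riesz-Fischer argument and, later, the limits of row space
  elements.\<close>

lemma AE_summable_of_nn_integral_le:
  fixes f :: "nat \<Rightarrow> 'a \<Rightarrow> real"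
  assumes [measurable]: "\<And>n. f n \<in> borel_measurable M" and nonneg: "\<And>n x. 0 \<le> f n x"
    and le: "\<And>n. (\<integral>\<^sup>+x. ennreal (f n x) \<partial>M) \<le> ennreal ((1/2) ^ n)"
  shows "AE x in M. summable (\<lambda>n. f n x)"
proof -
  have "(\<integral>\<^sup>+x. (\<Sum>n. ennreal (f n x)) \<partial>M) = (\<Sum>n. \<integral>\<^sup>+x. ennreal (f n x) \<partial>M)"
    by (rule nn_integral_suminf) simp
  also have "\<dots> \<le> (\<Sum>n. ennreal ((1/2) ^ n))"
    by (intro suminf_le le) auto
  also have "\<dots> < \<infinity>"
    unfolding infinity_ennreal_def less_top[symmetric]
    by (rule ennreal_suminf_neq_top) (auto simp: summable_geometric)
  finally have "(\<integral>\<^sup>+x. (\<Sum>n. ennreal (f n x)) \<partial>M) \<noteq> \<infinity>" by simp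
  then have "AE x in M. (\<Sum>n. ennreal (f n x)) \<noteq> \<infinity>"
    by (intro nn_integral_noteq_infinite) auto
  then show ?thesis
    by (rule AE_mp) (auto intro!: AE_I2 summable_suminf_not_top nonneg)
qed

lemma sqint_minus_commute: "sqint M (\<lambda>x. F x - G x) = sqint M (\<lambda>x. G x - F x)"
  by (simp add: sqint_def norm_minus_commute)

lemma sqint_eq_0_iff:
  "F \<in> borel_measurable M \<Longrightarrow> sqint M F = 0 \<longleftrightarrow> (AE x in M. F x = 0)"
  unfolding sqint_def by (subst nn_integral_0_iff_AE) (auto simp flip: ennreal_0)

text \<open>The mixed term is absorbed by completing the square. The factor \<open>1 + e\<close> on
  the first summand can be brought arbitrarily close to one; with the factor 2 of the cruder
  estimate, Parseval's identity would be reached only up to a constant.\<close>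

lemma cmod_add_sq_le_weighted:
  assumes e: "e > 0"
  shows "(cmod (a + b))\<^sup>2 \<le> (1 + e) * (cmod a)\<^sup>2 + (1 + 1 / e) * (cmod b)\<^sup>2"
proof -
  have "(cmod (a + b))\<^sup>2 \<le> (cmod a + cmod b)\<^sup>2"
    by (intro power_mono norm_triangle_ineq) auto
  also have "\<dots> = (cmod a)\<^sup>2 + (cmod b)\<^sup>2 + 2 * (cmod a * cmod b)"
    by (simp add: power2_sum)
  also have "2 * (cmod a * cmod b) \<le> e * (cmod a)\<^sup>2 + 1 / e * (cmod b)\<^sup>2"
  proof -
    have "0 \<le> (e * cmod a - cmod b)\<^sup>2 / e"
      using e by simp
    also have "\<dots> = e * (cmod a)\<^sup>2 + 1 / e * (cmod b)\<^sup>2 - 2 * (cmod a * cmod b)"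
      using e by (simp add: power2_eq_square field_simps)
    finally show ?thesis by simp
  qed
  finally show ?thesis by (simp add: algebra_simps)
qed

lemma sqint_add_le_weighted:
  assumes [measurable]: "F \<in> borel_measurable M" "G \<in> borel_measurable M" and e: "e > 0"
  shows "sqint M (\<lambda>x. F x + G x) \<le> ennreal (1 + e) * sqint M F + ennreal (1 + 1 / e) * sqint M G"
proof -
  have "sqint M (\<lambda>x. F x + G x) \<le>
      (\<integral>\<^sup>+x. ennreal (1 + e) * ennreal ((cmod (F x))\<^sup>2) + ennreal (1 + 1 / e) * ennreal ((cmod (G x))\<^sup>2) \<partial>M)"
    unfolding sqint_def
    using e cmod_add_sq_le_weighted[OF e]
    by (intro nn_integral_mono) (simp flip: ennreal_mult ennreal_plus)
  also have "\<dots> = ennreal (1 + e) * sqint M F + ennreal (1 + 1 / e) * sqint M G"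
    unfolding sqint_def by (simp add: nn_integral_add nn_integral_cmult)
  finally show ?thesis .
qed

lemma sqint_add_le:
  assumes "F \<in> borel_measurable M" "G \<in> borel_measurable M"
  shows "sqint M (\<lambda>x. F x + G x) \<le> 2 * sqint M F + 2 * sqint M G"
  using sqint_add_le_weighted[OF assms, of 1] by simp

lemma sqint_scale:
  assumes "F \<in> borel_measurable M"
  shows "sqint M (\<lambda>x. c * F x) = ennreal ((cmod c)\<^sup>2) * sqint M F"
  using assms unfolding sqint_def
  by (subst nn_integral_cmult[symmetric])
    (auto simp: norm_mult power_mult_distrib ennreal_mult intro!: nn_integral_cong)

lemma sqint_triangle:
  assumes "F \<in> borel_measurable M" "G \<in> borel_measurable M" "H \<in> borel_measurable M"
  shows "sqint M (\<lambda>x. F x - H x) \<le> 2 * sqint M (\<lambda>x. F x - G x) + 2 * sqint M (\<lambda>x. G x - H x)"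
  using sqint_add_le[of "\<lambda>x. F x - G x" M "\<lambda>x. G x - H x"] assms by simp

text \<open>Riesz-Fischer: along a subsequence the increments are almost everywhere dominated by a
  geometric series, and Fatou's lemma turns the pointwise limit into an \<open>L\<^sup>2\<close> limit.\<close>

lemma sqint_complete:
  fixes X :: "nat \<Rightarrow> 'a \<Rightarrow> complex"
  assumes [measurable]: "\<And>n. X n \<in> borel_measurable M"
    and Cauchy: "\<And>e. e > 0 \<Longrightarrow> \<exists>N. \<forall>m\<ge>N. \<forall>n\<ge>N. sqint M (\<lambda>x. X m x - X n x) \<le> ennreal e"
  obtains F where "F \<in> borel_measurable M"
    "\<And>e. e > 0 \<Longrightarrow> \<exists>N. \<forall>n\<ge>N. sqint M (\<lambda>x. F x - X n x) \<le> ennreal e"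
proof -
  \<comment> \<open>The rate \<open>1/8\<close> leaves room for the weight \<open>4 ^ i\<close>: the
    weighted increments still have integrals at most \<open>(1/2) ^ i\<close>, and once a weighted
    square is below one, the increment itself is below \<open>(1/2) ^ i\<close>.\<close>
  have "\<exists>N. \<forall>m\<ge>N. \<forall>n\<ge>N. sqint M (\<lambda>x. X m x - X n x) \<le> ennreal ((1/8) ^ i)" for i
    using Cauchy[of "(1/8) ^ i"] by simp
  then obtain N where N:
    "\<And>i m n. m \<ge> N i \<Longrightarrow> n \<ge> N i \<Longrightarrow> sqint M (\<lambda>x. X m x - X n x) \<le> ennreal ((1/8) ^ i)"
    by metis
  \<comment> \<open>The summand \<open>i\<close> makes \<open>s\<close> unbounded, and the sum makes
    it nondecreasing with \<open>N i \<le> s i\<close>.\<close>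
  define s where "s i = i + (\<Sum>j\<le>i. N j)" for i
  have s_ge: "N i \<le> s i" for i
    using member_le_sum[of i "{..i}" N] by (simp add: s_def)
  have s_Suc: "s i \<le> s (Suc i)" for i
    by (simp add: s_def)
  have s_id: "i \<le> s i" for i
    by (simp add: s_def)
  define D where "D i x = X (s (Suc i)) x - X (s i) x" for i x
  have [measurable]: "D i \<in> borel_measurable M" for i
    unfolding D_def[abs_def] by measurable
  have "(\<integral>\<^sup>+x. ennreal (4 ^ i * (cmod (D i x))\<^sup>2) \<partial>M) \<le> ennreal ((1/2) ^ i)" for i
  proof -
    have "(\<integral>\<^sup>+x. ennreal (4 ^ i * (cmod (D i x))\<^sup>2) \<partial>M) = ennreal (4 ^ i) * sqint M (D i)"
      unfolding sqint_def by (simp add: ennreal_mult nn_integral_cmult)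
    also have "\<dots> \<le> ennreal (4 ^ i) * ennreal ((1/8) ^ i)"
      unfolding D_def[abs_def] using order_trans[OF s_ge s_Suc] s_ge
      by (intro mult_left_mono N) auto
    also have "\<dots> = ennreal ((1/2) ^ i)"
      by (simp flip: ennreal_mult power_mult_distrib)
    finally show ?thesis .
  qed
  then have "AE x in M. summable (\<lambda>i. 4 ^ i * (cmod (D i x))\<^sup>2)"
    by (intro AE_summable_of_nn_integral_le) auto
  then have conv: "AE x in M. convergent (\<lambda>i. X (s i) x)"
  proof (rule AE_mp, intro AE_I2 impI)
    fix x assume "summable (\<lambda>i. 4 ^ i * (cmod (D i x))\<^sup>2)"
    then have "(\<lambda>i. 4 ^ i * (cmod (D i x))\<^sup>2) \<longlonglongrightarrow> 0"
      by (rule summable_LIMSEQ_zero)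
    then have "\<forall>\<^sub>F i in sequentially. 4 ^ i * (cmod (D i x))\<^sup>2 < 1"
      by (rule order_tendstoD) simp
    then have "\<forall>\<^sub>F i in sequentially. norm (D i x) \<le> (1/2) ^ i"
    proof eventually_elim
      case (elim i)
      have "(2 ^ i * cmod (D i x))\<^sup>2 = 4 ^ i * (cmod (D i x))\<^sup>2"
        by (simp add: power_mult_distrib flip: power_mult)
          (simp add: mult.commute[of i] power_mult)
      then have "(2 ^ i * cmod (D i x))\<^sup>2 < 1\<^sup>2" using elim by simp
      then have "2 ^ i * cmod (D i x) < 1"
        by (rule power2_less_imp_less) simp
      then show ?case by (simp add: power_divide pos_le_divide_eq mult.commute)
    qed
    then have "summable (\<lambda>i. D i x)"
      by (rule summable_comparison_test_ev) (simp add: summable_geometric)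
    then have "convergent (\<lambda>n. X (s 0) x + (\<Sum>i<n. D i x))"
      by (intro convergent_add convergent_const) (simp add: summable_iff_convergent)
    then show "convergent (\<lambda>i. X (s i) x)"
      by (simp add: D_def sum_lessThan_telescope[of "\<lambda>i. X (s i) x"])
  qed
  define F where "F x = lim (\<lambda>i. X (s i) x)" for x
  have F[measurable]: "F \<in> borel_measurable M"
    unfolding F_def[abs_def] by measurable
  show thesis
  proof (rule that[OF F])
    fix e :: real assume "e > 0"
    then obtain K where K: "\<And>m n. m \<ge> K \<Longrightarrow> n \<ge> K \<Longrightarrow> sqint M (\<lambda>x. X m x - X n x) \<le> ennreal e"
      using Cauchy by blast
    have "sqint M (\<lambda>x. F x - X n x) \<le> ennreal e" if n: "n \<ge> K" for n
    proof -
      have "sqint M (\<lambda>x. F x - X n x) =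
          (\<integral>\<^sup>+x. liminf (\<lambda>i. ennreal ((cmod (X (s i) x - X n x))\<^sup>2)) \<partial>M)"
        unfolding sqint_def
      proof (rule nn_integral_cong_AE, rule AE_mp[OF conv], intro AE_I2 impI)
        fix x assume "convergent (\<lambda>i. X (s i) x)"
        then have "(\<lambda>i. X (s i) x) \<longlonglongrightarrow> F x"
          by (simp add: F_def convergent_LIMSEQ_iff)
        then have "(\<lambda>i. ennreal ((cmod (X (s i) x - X n x))\<^sup>2)) \<longlonglongrightarrow> ennreal ((cmod (F x - X n x))\<^sup>2)"
          by (intro tendsto_intros)
        then show "ennreal ((cmod (F x - X n x))\<^sup>2) = liminf (\<lambda>i. ennreal ((cmod (X (s i) x - X n x))\<^sup>2))"
          by (rule lim_imp_Liminf[OF trivial_limit_sequentially, symmetric])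
      qed
      also have "\<dots> \<le> liminf (\<lambda>i. sqint M (\<lambda>x. X (s i) x - X n x))"
        unfolding sqint_def by (rule nn_integral_liminf) simp
      also have "\<dots> \<le> limsup (\<lambda>i. sqint M (\<lambda>x. X (s i) x - X n x))"
        by (rule Liminf_le_Limsup) simp
      also have "\<dots> \<le> ennreal e"
      proof (rule Limsup_bounded)
        show "\<forall>\<^sub>F i in sequentially. sqint M (\<lambda>x. X (s i) x - X n x) \<le> ennreal e"
          using eventually_ge_at_top[of K]
        proof eventually_elim
          case (elim i)
          then show ?case using s_id[of i] n by (intro K) auto
        qed
      qed
      finally show ?thesis .
    qed
    then show "\<exists>N. \<forall>n\<ge>N. sqint M (\<lambda>x. F x - X n x) \<le> ennreal e" by blast
  qed
qed

section \<open>Fourier series\<close>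

definition fexp :: "int \<Rightarrow> real \<Rightarrow> complex" where
  "fexp k \<theta> = exp (2 * of_real pi * \<i> * of_int k * of_real \<theta>)"

lemma fexp_0 [simp]: "fexp 0 \<theta> = 1"
  by (simp add: fexp_def)

lemma fexp_add: "fexp (k + l) \<theta> = fexp k \<theta> * fexp l \<theta>"
  by (simp add: fexp_def algebra_simps flip: exp_add)

lemma norm_fexp [simp]: "cmod (fexp k \<theta>) = 1"
  by (simp add: fexp_def norm_exp_eq_Re)

lemma cnj_fexp: "cnj (fexp k \<theta>) = fexp (- k) \<theta>"
  by (simp add: fexp_def exp_cnj)

lemma fexp_periodic: "fexp k (\<theta> + 1) = fexp k \<theta>"
proof -
  have "exp (complex_of_real (2 * of_int k * pi) * \<i>) = 1"
    using exp_integer_2pi[of "of_int k"] by simp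
  then show ?thesis
    by (simp add: fexp_def distrib_left exp_add ac_simps)
qed

lemma continuous_fexp [continuous_intros]: "continuous_on A (fexp k)"
  unfolding fexp_def[abs_def] by (intro continuous_intros)

lemma borel_measurable_fexp [measurable]: "fexp k \<in> borel_measurable borel"
  by (intro borel_measurable_continuous_onI continuous_fexp)

abbreviation unit_interval :: "real measure" where
  "unit_interval \<equiv> restrict_space lborel {0..<1}"

lemma emeasure_unit_interval: "emeasure unit_interval (space unit_interval) = 1"
  by (simp add: emeasure_restrict_space)

interpretation unit_interval: finite_measure unit_interval
  by (rule finite_measureI) (subst emeasure_unit_interval, simp)

lemma AE_unit_interval: "(AE \<theta> in unit_interval. P \<theta>) \<longleftrightarrow> (AE \<theta> in lborel. \<theta> \<in> {0..<1} \<longrightarrow> P \<theta>)"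
  by (subst AE_restrict_space_iff) auto

lemma measurable_unit_interval:
  "F \<in> borel_measurable borel \<Longrightarrow> F \<in> borel_measurable unit_interval"
  by (rule measurable_restrict_space1) simp

lemma integral_fexp: "integral\<^sup>L unit_interval (fexp k) = (if k = 0 then 1 else 0)"
proof -
  have "integral\<^sup>L unit_interval (fexp k) = (\<integral>x. indicator {0..<1} x *\<^sub>R fexp k x \<partial>lborel)"
    by (subst integral_restrict_space) auto
  also have "\<dots> = (\<integral>x. indicator {0..1} x *\<^sub>R fexp k x \<partial>lborel)"
  proof (rule integral_cong_AE)
    show "AE x in lborel. indicator {0..<1} x *\<^sub>R fexp k x = indicator {0..1} x *\<^sub>R fexp k x"
      using AE_lborel_singleton[of 1] by eventually_elim (auto simp: indicator_def)
  qed simp_all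
  also have "\<dots> = (if k = 0 then 1 else 0)"
  proof (cases "k = 0")
    case False
    define F where "F x = fexp k x / (2 * of_real pi * \<i> * of_int k)" for x
    have "(F has_vector_derivative fexp k x) (at x within {0..1})" for x
    proof -
      have "((\<lambda>z. exp (2 * of_real pi * \<i> * of_int k * z) / (2 * of_real pi * \<i> * of_int k))
          has_field_derivative exp (2 * of_real pi * \<i> * of_int k * of_real x)) (at (of_real x))"
        using False by (auto intro!: derivative_eq_intros simp: field_simps)
      from has_vector_derivative_real_field[OF this]
      show ?thesis
        unfolding F_def fexp_def by (rule has_vector_derivative_at_within)
    qed
    then have "(\<integral>x. indicator {0..1} x *\<^sub>R fexp k x \<partial>lborel) = F 1 - F 0"
      by (intro integral_FTC_Icc continuous_intros) auto
    also have "\<dots> = 0"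
      using fexp_periodic[of k 0] by (simp add: F_def)
    finally show ?thesis using False by simp
  qed simp
  finally show ?thesis .
qed

lemma integrable_unit_interval_bounded:
  fixes F :: "real \<Rightarrow> 'b::{banach, second_countable_topology}"
  assumes "F \<in> borel_measurable unit_interval" "\<And>\<theta>. norm (F \<theta>) \<le> B"
  shows "integrable unit_interval F"
  using assms by (intro unit_interval.integrable_const_bound[of _ B]) auto

definition trig_poly :: "(int \<Rightarrow> complex) \<Rightarrow> int set \<Rightarrow> real \<Rightarrow> complex" where
  "trig_poly c A \<theta> = (\<Sum>k\<in>A. c k * fexp k \<theta>)"

lemma borel_measurable_trig_poly [measurable]: "trig_poly c A \<in> borel_measurable borel"
  unfolding trig_poly_def[abs_def] by measurable

text \<open>Parseval's identity for finite sums: the square expands into a double sum whose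
  off-diagonal terms integrate to zero.\<close>

lemma sqint_trig_poly:
  assumes A: "finite A"
  shows "sqint unit_interval (trig_poly c A) = ennreal (\<Sum>k\<in>A. (cmod (c k))\<^sup>2)"
proof -
  have bound: "cmod (trig_poly c A \<theta>) \<le> (\<Sum>k\<in>A. cmod (c k))" for \<theta>
    unfolding trig_poly_def by (rule sum_norm_le) (simp add: norm_mult)
  have int: "integrable unit_interval (\<lambda>\<theta>. (cmod (trig_poly c A \<theta>))\<^sup>2)"
    by (rule integrable_unit_interval_bounded[of _ "(\<Sum>k\<in>A. cmod (c k))\<^sup>2"])
      (auto intro!: power_mono bound measurable_unit_interval)
  have intf: "integrable unit_interval (\<lambda>\<theta>. a * fexp k \<theta>)" for a k
    by (rule integrable_unit_interval_bounded[of _ "cmod a"]) (auto simp: norm_mult intro!: measurable_unit_interval)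
  have sq: "complex_of_real ((cmod (trig_poly c A \<theta>))\<^sup>2) =
      (\<Sum>k\<in>A. \<Sum>l\<in>A. c k * cnj (c l) * fexp (k - l) \<theta>)" for \<theta>
    unfolding complex_norm_square trig_poly_def cnj_sum sum_product
    by (intro sum.cong refl) (simp add: cnj_fexp fexp_add[of k "- l" for k l, simplified])
  have "complex_of_real (\<integral>\<theta>. (cmod (trig_poly c A \<theta>))\<^sup>2 \<partial>unit_interval) =
      (\<integral>\<theta>. complex_of_real ((cmod (trig_poly c A \<theta>))\<^sup>2) \<partial>unit_interval)"
    by (rule integral_complex_of_real[symmetric])
  also have "\<dots> = (\<Sum>k\<in>A. \<Sum>l\<in>A. c k * cnj (c l) * (if k - l = 0 then 1 else 0))"
    unfolding sq by (simp add: intf integral_fexp)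
  also have "\<dots> = complex_of_real (\<Sum>k\<in>A. (cmod (c k))\<^sup>2)"
    unfolding of_real_sum complex_norm_square
    using A by (simp add: if_distrib sum.delta' cong: if_cong)
  finally have "(\<integral>\<theta>. (cmod (trig_poly c A \<theta>))\<^sup>2 \<partial>unit_interval) = (\<Sum>k\<in>A. (cmod (c k))\<^sup>2)"
    using of_real_eq_iff by blast
  then show ?thesis
    unfolding sqint_def using int by (simp add: nn_integral_eq_integral)
qed

text \<open>Common terms cancel, so the difference lives on the symmetric difference of the index
  sets. The sign does not affect moduli, and the distance of two partial sums is thereby governed by
  a tail of the coefficients.\<close>

lemma trig_poly_diff:
  assumes "finite A" "finite B"
  shows "trig_poly c A \<theta> - trig_poly c B \<theta> =
    trig_poly (\<lambda>k. if k \<in> A then c k else - c k) ((A - B) \<union> (B - A)) \<theta>"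
proof -
  have "trig_poly c A \<theta> = (\<Sum>k\<in>A - B. c k * fexp k \<theta>) + (\<Sum>k\<in>A \<inter> B. c k * fexp k \<theta>)"
    unfolding trig_poly_def using sum.Int_Diff[OF assms(1), of "\<lambda>k. c k * fexp k \<theta>" B] by (simp add: add.commute)
  moreover have "trig_poly c B \<theta> = (\<Sum>k\<in>B - A. c k * fexp k \<theta>) + (\<Sum>k\<in>A \<inter> B. c k * fexp k \<theta>)"
    unfolding trig_poly_def using sum.Int_Diff[OF assms(2), of "\<lambda>k. c k * fexp k \<theta>" A] by (simp add: Int_commute add.commute)
  moreover have "trig_poly (\<lambda>k. if k \<in> A then c k else - c k) ((A - B) \<union> (B - A)) \<theta> =
      (\<Sum>k\<in>A - B. c k * fexp k \<theta>) + (\<Sum>k\<in>B - A. - (c k * fexp k \<theta>))"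
    unfolding trig_poly_def using assms
    by (subst sum.union_disjoint) (auto intro!: arg_cong2[where f = "(+)"] sum.cong)
  ultimately show ?thesis by (simp add: sum_negf)
qed

lemma square_summable_tail:
  assumes c: "square_summable c" and e: "e > 0"
  obtains E where "finite E" "\<And>A. finite A \<Longrightarrow> A \<inter> E = {} \<Longrightarrow> (\<Sum>k\<in>A. (cmod (c k))\<^sup>2) \<le> e"
proof -
  obtain E where E: "finite E" "dist (\<Sum>k\<in>E. (cmod (c k))\<^sup>2) (\<Sum>\<^sub>\<infinity>k. (cmod (c k))\<^sup>2) \<le> e"
    using infsum_finite_approximation[of "\<lambda>k. (cmod (c k))\<^sup>2" UNIV e] c e
    by (auto simp: square_summable_def)
  have "(\<Sum>k\<in>A. (cmod (c k))\<^sup>2) \<le> e" if A: "finite A" "A \<inter> E = {}" for A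
  proof -
    have "(\<Sum>k\<in>A. (cmod (c k))\<^sup>2) + (\<Sum>k\<in>E. (cmod (c k))\<^sup>2) = (\<Sum>k\<in>A \<union> E. (cmod (c k))\<^sup>2)"
      using A E(1) by (simp add: sum.union_disjoint)
    also have "\<dots> \<le> sqnorm c"
      using A E(1) by (intro sum_le_sqnorm c) auto
    finally show ?thesis using E(2) by (simp add: dist_real_def sqnorm_def)
  qed
  with E(1) that show thesis by blast
qed

text \<open>Two finite sets containing \<open>E\<close> differ only outside \<open>E\<close>, where
  the coefficients have small total mass. This is the Cauchy property along the net of finite sets,
  stronger than that of one chosen sequence of partial sums.\<close>

lemma sqint_trig_poly_Cauchy:
  assumes c: "square_summable c" and e: "e > 0"
  obtains E where "finite E"
    "\<And>A B. finite A \<Longrightarrow> finite B \<Longrightarrow> E \<subseteq> A \<Longrightarrow> E \<subseteq> B \<Longrightarrow>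
      sqint unit_interval (\<lambda>\<theta>. trig_poly c A \<theta> - trig_poly c B \<theta>) \<le> ennreal e"
proof -
  obtain E where E: "finite E" "\<And>A. finite A \<Longrightarrow> A \<inter> E = {} \<Longrightarrow> (\<Sum>k\<in>A. (cmod (c k))\<^sup>2) \<le> e"
    using square_summable_tail[OF c e] by blast
  have "sqint unit_interval (\<lambda>\<theta>. trig_poly c A \<theta> - trig_poly c B \<theta>) \<le> ennreal e"
    if AB: "finite A" "finite B" "E \<subseteq> A" "E \<subseteq> B" for A B
  proof -
    have "sqint unit_interval (\<lambda>\<theta>. trig_poly c A \<theta> - trig_poly c B \<theta>) =
        ennreal (\<Sum>k\<in>(A - B) \<union> (B - A). (cmod (if k \<in> A then c k else - c k))\<^sup>2)"
      unfolding trig_poly_diff[OF AB(1,2)] using AB by (subst sqint_trig_poly) auto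
    also have "(\<Sum>k\<in>(A - B) \<union> (B - A). (cmod (if k \<in> A then c k else - c k))\<^sup>2) =
        (\<Sum>k\<in>(A - B) \<union> (B - A). (cmod (c k))\<^sup>2)"
      by (intro sum.cong) auto
    also have "\<dots> \<le> e"
      using AB by (intro E(2)) auto
    finally show ?thesis by (simp add: ennreal_leI)
  qed
  with E(1) that show thesis by blast
qed

text \<open>A relation and not a function of \<open>c\<close>, since the limit is determined only up
  to null sets: sums, multiples and shifts of representatives are again representatives, whereas
  chosen ones would match only almost everywhere. The convergence of the net is written out with
  finite sets.\<close>

definition fourier_series :: "(int \<Rightarrow> complex) \<Rightarrow> (real \<Rightarrow> complex) \<Rightarrow> bool" where
  "fourier_series c F \<longleftrightarrow> F \<in> borel_measurable borel \<and> (\<forall>\<theta>. F (\<theta> + 1) = F \<theta>) \<and>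
    (\<forall>e>0. \<exists>E. finite E \<and> (\<forall>A. finite A \<longrightarrow> E \<subseteq> A \<longrightarrow>
      sqint unit_interval (\<lambda>\<theta>. F \<theta> - trig_poly c A \<theta>) \<le> ennreal e))"

lemma fourier_series_measurable: "fourier_series c F \<Longrightarrow> F \<in> borel_measurable borel"
  by (simp add: fourier_series_def)

lemma fourier_series_measurable': "fourier_series c F \<Longrightarrow> F \<in> borel_measurable unit_interval"
  by (intro measurable_unit_interval fourier_series_measurable)

lemma fourier_series_approx:
  assumes "fourier_series c F" "e > 0"
  obtains E where "finite E" "\<And>A. finite A \<Longrightarrow> E \<subseteq> A \<Longrightarrow>
    sqint unit_interval (\<lambda>\<theta>. F \<theta> - trig_poly c A \<theta>) \<le> ennreal e"
  using assms unfolding fourier_series_def by blast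

lemma ennreal_tendsto_0_iff_le:
  fixes f :: "'a \<Rightarrow> ennreal"
  shows "(f \<longlongrightarrow> 0) F \<longleftrightarrow> (\<forall>e>0. \<forall>\<^sub>F x in F. f x \<le> ennreal e)"
proof
  assume f: "(f \<longlongrightarrow> 0) F"
  show "\<forall>e>0. \<forall>\<^sub>F x in F. f x \<le> ennreal e"
  proof (intro allI impI)
    fix e :: real assume "e > 0"
    then have "\<forall>\<^sub>F x in F. f x < ennreal e"
      by (intro order_tendstoD(2)[OF f]) simp
    then show "\<forall>\<^sub>F x in F. f x \<le> ennreal e"
      by (rule eventually_mono) simp
  qed
next
  assume R: "\<forall>e>0. \<forall>\<^sub>F x in F. f x \<le> ennreal e"
  show "(f \<longlongrightarrow> 0) F"
  proof (rule order_tendstoI)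
    fix a :: ennreal assume "0 < a"
    then obtain b where b: "0 < b" "b < a" using dense by blast
    obtain r where r: "b = ennreal r" "r > 0"
      using b by (cases b) (auto simp: ennreal_less_zero_iff)
    then have "\<forall>\<^sub>F x in F. f x \<le> b" using R by blast
    then show "\<forall>\<^sub>F x in F. f x < a"
      by (rule eventually_mono) (use b in auto)
  qed auto
qed

lemma is_zak_iff: "is_zak K h j F \<longleftrightarrow> fourier_series (\<lambda>k. h (j + k * int K)) F"
proof -
  have "(\<integral>\<^sup>+\<theta>\<in>{0..<1}. ennreal ((cmod (F \<theta> -
         (\<Sum>k\<in>A. h (j + k * int K) * exp (2 * of_real pi * \<i> * of_int k * of_real \<theta>))))\<^sup>2) \<partial>lborel) =
      sqint unit_interval (\<lambda>\<theta>. F \<theta> - trig_poly (\<lambda>k. h (j + k * int K)) A \<theta>)" for A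
    unfolding sqint_def by (subst nn_integral_restrict_space) (auto simp: trig_poly_def fexp_def)
  then show ?thesis
    unfolding is_zak_def fourier_series_def
    by (simp add: ennreal_tendsto_0_iff_le eventually_finite_subsets_at_top imp_conjL)
qed

text \<open>The symmetric partial sums form a sequence to which completeness applies. They are
  members of the net, so the Cauchy property of the net carries the limit over to all large finite
  sets.\<close>

lemma fourier_series_exists:
  assumes c: "square_summable c"
  obtains F where "fourier_series c F"
proof -
  define X where "X n = trig_poly c {- int n..int n}" for n
  have X[measurable]: "X n \<in> borel_measurable unit_interval" for n
    unfolding X_def by (intro measurable_unit_interval) simp
  have ex: "\<exists>N. \<forall>n\<ge>N. E \<subseteq> {- int n..int n}" if "finite E" for E
  proof -
    have "\<bar>k\<bar> \<le> (\<Sum>k\<in>E. \<bar>k\<bar>)" if "k \<in> E" for k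
      using \<open>finite E\<close> that by (intro member_le_sum) auto
    then have "E \<subseteq> {- int n..int n}" if "n \<ge> nat (\<Sum>k\<in>E. \<bar>k\<bar>)" for n
      using that by fastforce
    then show ?thesis by blast
  qed
  have "\<exists>N. \<forall>m\<ge>N. \<forall>n\<ge>N. sqint unit_interval (\<lambda>\<theta>. X m \<theta> - X n \<theta>) \<le> ennreal e" if "e > 0" for e
  proof -
    obtain E where E: "finite E"
      "\<And>A B. finite A \<Longrightarrow> finite B \<Longrightarrow> E \<subseteq> A \<Longrightarrow> E \<subseteq> B \<Longrightarrow>
        sqint unit_interval (\<lambda>\<theta>. trig_poly c A \<theta> - trig_poly c B \<theta>) \<le> ennreal e"
      using sqint_trig_poly_Cauchy[OF c \<open>e > 0\<close>] by blast
    obtain N where N: "\<And>n. n \<ge> N \<Longrightarrow> E \<subseteq> {- int n..int n}"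
      using ex[OF E(1)] by blast
    have "sqint unit_interval (\<lambda>\<theta>. X m \<theta> - X n \<theta>) \<le> ennreal e" if "m \<ge> N" "n \<ge> N" for m n
      unfolding X_def by (intro E(2) N that) auto
    then show ?thesis by blast
  qed
  then obtain G where G: "G \<in> borel_measurable unit_interval"
    "\<And>e. e > 0 \<Longrightarrow> \<exists>N. \<forall>n\<ge>N. sqint unit_interval (\<lambda>\<theta>. G \<theta> - X n \<theta>) \<le> ennreal e"
    by (rule sqint_complete[of X unit_interval, OF X]) (assumption | blast)+
  \<comment> \<open>\<open>G\<close> is measurable only relative to the unit interval; composition
    with \<open>frac\<close> gives a Borel function of period one with the same values
    there.\<close>
  define F where "F \<theta> = G (frac \<theta>)" for \<theta>
  have frac: "frac \<in> borel \<rightarrow>\<^sub>M unit_interval"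
  proof (rule measurable_restrict_space2)
    show "(frac :: real \<Rightarrow> real) \<in> space borel \<rightarrow> {0..<1}"
      by (auto simp: frac_ge_0 frac_lt_1)
    show "(frac :: real \<Rightarrow> real) \<in> borel \<rightarrow>\<^sub>M lborel"
      unfolding frac_def[abs_def]
      using borel_measurable_diff[OF measurable_ident borel_measurable_real_floor]
      by (simp add: id_def)
  qed
  have F: "F \<in> borel_measurable borel"
    unfolding F_def[abs_def] using measurable_compose[OF frac G(1)] .
  have period: "F (\<theta> + 1) = F \<theta>" for \<theta>
    using frac_1_eq[of \<theta>] by (simp add: F_def)
  have FG: "sqint unit_interval (\<lambda>\<theta>. F \<theta> - H \<theta>) = sqint unit_interval (\<lambda>\<theta>. G \<theta> - H \<theta>)" for H
    unfolding sqint_def F_def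
    by (intro nn_integral_cong) (auto simp: space_restrict_space frac_eq)
  have "\<exists>E. finite E \<and> (\<forall>A. finite A \<longrightarrow> E \<subseteq> A \<longrightarrow>
      sqint unit_interval (\<lambda>\<theta>. F \<theta> - trig_poly c A \<theta>) \<le> ennreal e)" if "e > 0" for e
  proof -
    obtain E where E: "finite E"
      "\<And>A B. finite A \<Longrightarrow> finite B \<Longrightarrow> E \<subseteq> A \<Longrightarrow> E \<subseteq> B \<Longrightarrow>
        sqint unit_interval (\<lambda>\<theta>. trig_poly c A \<theta> - trig_poly c B \<theta>) \<le> ennreal (e / 4)"
      using sqint_trig_poly_Cauchy[OF c, of "e / 4"] \<open>e > 0\<close> by auto
    obtain N1 where N1: "\<And>n. n \<ge> N1 \<Longrightarrow> E \<subseteq> {- int n..int n}"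
      using ex[OF E(1)] by blast
    obtain N2 where N2: "\<And>n. n \<ge> N2 \<Longrightarrow> sqint unit_interval (\<lambda>\<theta>. G \<theta> - X n \<theta>) \<le> ennreal (e / 4)"
      using G(2)[of "e / 4"] \<open>e > 0\<close> by auto
    define n where "n = max N1 N2"
    have "sqint unit_interval (\<lambda>\<theta>. F \<theta> - trig_poly c A \<theta>) \<le> ennreal e" if A: "finite A" "E \<subseteq> A" for A
    proof -
      have "sqint unit_interval (\<lambda>\<theta>. F \<theta> - trig_poly c A \<theta>) \<le>
          2 * sqint unit_interval (\<lambda>\<theta>. F \<theta> - X n \<theta>) +
          2 * sqint unit_interval (\<lambda>\<theta>. X n \<theta> - trig_poly c A \<theta>)"
        by (intro sqint_triangle X measurable_unit_interval F) simp
      also have "\<dots> \<le> 2 * ennreal (e / 4) + 2 * ennreal (e / 4)"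
        unfolding FG using N2[of n] E(2)[of "{- int n..int n}" A] N1[of n] A
        by (intro add_mono mult_left_mono) (auto simp: X_def n_def)
      also have "\<dots> = ennreal e"
        using \<open>e > 0\<close> by (simp flip: ennreal_plus ennreal_numeral ennreal_mult)
      finally show ?thesis .
    qed
    then show ?thesis using E(1) by blast
  qed
  then have "fourier_series c F"
    unfolding fourier_series_def using F period by blast
  then show thesis by (rule that)
qed

section \<open>Operations on Fourier series and Parseval's identity\<close>

lemma fourier_series_add:
  assumes F: "fourier_series c F" and G: "fourier_series d G"
  shows "fourier_series (\<lambda>k. c k + d k) (\<lambda>\<theta>. F \<theta> + G \<theta>)"
  unfolding fourier_series_def
proof (intro conjI allI impI)
  show "(\<lambda>\<theta>. F \<theta> + G \<theta>) \<in> borel_measurable borel"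
    by (intro borel_measurable_add fourier_series_measurable[OF F] fourier_series_measurable[OF G])
  show "F (\<theta> + 1) + G (\<theta> + 1) = F \<theta> + G \<theta>" for \<theta>
    using F G by (simp add: fourier_series_def)
  fix e :: real assume "e > 0"
  then have e: "e / 4 > 0" by simp
  obtain E where E: "finite E" "\<And>A. finite A \<Longrightarrow> E \<subseteq> A \<Longrightarrow>
      sqint unit_interval (\<lambda>\<theta>. F \<theta> - trig_poly c A \<theta>) \<le> ennreal (e / 4)"
    using fourier_series_approx[OF F e] by blast
  obtain E' where E': "finite E'" "\<And>A. finite A \<Longrightarrow> E' \<subseteq> A \<Longrightarrow>
      sqint unit_interval (\<lambda>\<theta>. G \<theta> - trig_poly d A \<theta>) \<le> ennreal (e / 4)"
    using fourier_series_approx[OF G e] by blast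
  have "sqint unit_interval (\<lambda>\<theta>. F \<theta> + G \<theta> - trig_poly (\<lambda>k. c k + d k) A \<theta>) \<le> ennreal e"
    if A: "finite A" "E \<union> E' \<subseteq> A" for A
  proof -
    have "sqint unit_interval (\<lambda>\<theta>. F \<theta> + G \<theta> - trig_poly (\<lambda>k. c k + d k) A \<theta>) =
        sqint unit_interval (\<lambda>\<theta>. (F \<theta> - trig_poly c A \<theta>) + (G \<theta> - trig_poly d A \<theta>))"
      by (simp add: trig_poly_def algebra_simps sum.distrib)
    also have "\<dots> \<le> 2 * sqint unit_interval (\<lambda>\<theta>. F \<theta> - trig_poly c A \<theta>) +
        2 * sqint unit_interval (\<lambda>\<theta>. G \<theta> - trig_poly d A \<theta>)"
      by (intro sqint_add_le measurable_unit_interval borel_measurable_diff borel_measurable_trig_poly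
          fourier_series_measurable[OF F] fourier_series_measurable[OF G])
    also have "\<dots> \<le> 2 * ennreal (e / 4) + 2 * ennreal (e / 4)"
      using A by (intro add_mono mult_left_mono E(2) E'(2)) auto
    also have "\<dots> = ennreal e"
      using e by (simp flip: ennreal_plus ennreal_numeral ennreal_mult)
    finally show ?thesis .
  qed
  then show "\<exists>E. finite E \<and> (\<forall>A. finite A \<longrightarrow> E \<subseteq> A \<longrightarrow>
      sqint unit_interval (\<lambda>\<theta>. F \<theta> + G \<theta> - trig_poly (\<lambda>k. c k + d k) A \<theta>) \<le> ennreal e)"
    using E(1) E'(1) by (intro exI[of _ "E \<union> E'"]) auto
qed

lemma fourier_series_scale:
  assumes F: "fourier_series c F"
  shows "fourier_series (\<lambda>k. a * c k) (\<lambda>\<theta>. a * F \<theta>)"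
  unfolding fourier_series_def
proof (intro conjI allI impI)
  show "(\<lambda>\<theta>. a * F \<theta>) \<in> borel_measurable borel"
    by (intro borel_measurable_times borel_measurable_const fourier_series_measurable[OF F])
  show "a * F (\<theta> + 1) = a * F \<theta>" for \<theta>
    using F by (simp add: fourier_series_def)
  fix e :: real assume "e > 0"
  define d where "d = e / ((cmod a)\<^sup>2 + 1)"
  have "(cmod a)\<^sup>2 + 1 > 0" by (simp add: add_nonneg_pos)
  then have d: "d > 0" "(cmod a)\<^sup>2 * d \<le> e"
    using \<open>e > 0\<close> by (auto simp: d_def field_simps)
  obtain E where E: "finite E" "\<And>A. finite A \<Longrightarrow> E \<subseteq> A \<Longrightarrow>
      sqint unit_interval (\<lambda>\<theta>. F \<theta> - trig_poly c A \<theta>) \<le> ennreal d"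
    using fourier_series_approx[OF F d(1)] by blast
  have "sqint unit_interval (\<lambda>\<theta>. a * F \<theta> - trig_poly (\<lambda>k. a * c k) A \<theta>) \<le> ennreal e"
    if A: "finite A" "E \<subseteq> A" for A
  proof -
    have "sqint unit_interval (\<lambda>\<theta>. a * F \<theta> - trig_poly (\<lambda>k. a * c k) A \<theta>) =
        sqint unit_interval (\<lambda>\<theta>. a * (F \<theta> - trig_poly c A \<theta>))"
      by (simp add: trig_poly_def algebra_simps sum_distrib_left)
    also have "\<dots> = ennreal ((cmod a)\<^sup>2) * sqint unit_interval (\<lambda>\<theta>. F \<theta> - trig_poly c A \<theta>)"
      by (intro sqint_scale measurable_unit_interval borel_measurable_diff borel_measurable_trig_poly
          fourier_series_measurable[OF F])
    also have "\<dots> \<le> ennreal ((cmod a)\<^sup>2) * ennreal d"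
      using A by (intro mult_left_mono E(2)) auto
    also have "\<dots> \<le> ennreal e"
      using d by (simp add: ennreal_leI flip: ennreal_mult)
    finally show ?thesis .
  qed
  then show "\<exists>E. finite E \<and> (\<forall>A. finite A \<longrightarrow> E \<subseteq> A \<longrightarrow>
      sqint unit_interval (\<lambda>\<theta>. a * F \<theta> - trig_poly (\<lambda>k. a * c k) A \<theta>) \<le> ennreal e)"
    using E(1) by blast
qed

lemma fourier_series_diff:
  assumes "fourier_series c F" "fourier_series d G"
  shows "fourier_series (\<lambda>k. c k - d k) (\<lambda>\<theta>. F \<theta> - G \<theta>)"
  using fourier_series_add[OF assms(1) fourier_series_scale[OF assms(2), of "- 1"]] by simp

lemma fourier_series_zero: "fourier_series (\<lambda>k. 0) (\<lambda>\<theta>. 0)"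
  by (auto simp: fourier_series_def trig_poly_def sqint_def)

lemma fourier_series_delta: "fourier_series (\<lambda>k. if k = 0 then 1 else 0) (\<lambda>\<theta>. 1)"
proof -
  have "trig_poly (\<lambda>k. if k = 0 then 1 else 0) A \<theta> = 1" if "finite A" "{0} \<subseteq> A" for A \<theta>
  proof -
    have "trig_poly (\<lambda>k. if k = 0 then 1 else 0) A \<theta> = (\<Sum>k\<in>{0}. (if k = 0 then 1 else 0) * fexp k \<theta>)"
      unfolding trig_poly_def using that by (intro sum.mono_neutral_right) auto
    then show ?thesis by simp
  qed
  then show ?thesis
    unfolding fourier_series_def by (auto simp: sqint_def intro!: exI[of _ "{0}"])
qed

text \<open>A shift of the coefficients is multiplication by a character, whose modulus is one, so
  all approximation errors are unchanged. This is how a translation by a multiple of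
  \<open>p * M\<close> acts on Zak transforms.\<close>

lemma fourier_series_shift:
  assumes F: "fourier_series c F"
  shows "fourier_series (\<lambda>k. c (k - t)) (\<lambda>\<theta>. fexp t \<theta> * F \<theta>)"
  unfolding fourier_series_def
proof (intro conjI allI impI)
  show "(\<lambda>\<theta>. fexp t \<theta> * F \<theta>) \<in> borel_measurable borel"
    by (intro borel_measurable_times borel_measurable_fexp fourier_series_measurable[OF F])
  show "fexp t (\<theta> + 1) * F (\<theta> + 1) = fexp t \<theta> * F \<theta>" for \<theta>
    using F by (simp add: fourier_series_def fexp_periodic)
  fix e :: real assume "e > 0"
  obtain E where E: "finite E" "\<And>A. finite A \<Longrightarrow> E \<subseteq> A \<Longrightarrow>
      sqint unit_interval (\<lambda>\<theta>. F \<theta> - trig_poly c A \<theta>) \<le> ennreal e"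
    using fourier_series_approx[OF F \<open>e > 0\<close>] by blast
  have "sqint unit_interval (\<lambda>\<theta>. fexp t \<theta> * F \<theta> - trig_poly (\<lambda>k. c (k - t)) A \<theta>) \<le> ennreal e"
    if A: "finite A" "(\<lambda>k. k + t) ` E \<subseteq> A" for A
  proof -
    have "trig_poly (\<lambda>k. c (k - t)) A \<theta> = fexp t \<theta> * trig_poly c ((\<lambda>k. k - t) ` A) \<theta>" for \<theta>
      unfolding trig_poly_def sum_distrib_left
      by (subst sum.reindex) (auto simp: inj_on_def o_def algebra_simps simp flip: fexp_add)
    then have "sqint unit_interval (\<lambda>\<theta>. fexp t \<theta> * F \<theta> - trig_poly (\<lambda>k. c (k - t)) A \<theta>) =
        sqint unit_interval (\<lambda>\<theta>. F \<theta> - trig_poly c ((\<lambda>k. k - t) ` A) \<theta>)"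
      unfolding sqint_def by (simp add: norm_mult flip: right_diff_distrib)
    also have "\<dots> \<le> ennreal e"
      using A by (intro E(2)) force+
    finally show ?thesis .
  qed
  then show "\<exists>E. finite E \<and> (\<forall>A. finite A \<longrightarrow> E \<subseteq> A \<longrightarrow>
      sqint unit_interval (\<lambda>\<theta>. fexp t \<theta> * F \<theta> - trig_poly (\<lambda>k. c (k - t)) A \<theta>) \<le> ennreal e)"
    using E(1) by (intro exI[of _ "(\<lambda>k. k + t) ` E"]) auto
qed

text \<open>Parseval's identity, by comparing \<open>F\<close> with a partial sum in both
  directions. The error of the partial sum is taken to be \<open>e\<^sup>2\<close> because the
  weighted inequality multiplies it by \<open>1 + 1 / e\<close>; the product
  \<open>e\<^sup>2 + e\<close> still tends to zero.\<close>

lemma sqint_fourier_series: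
  assumes F: "fourier_series c F" and c: "square_summable c"
  shows "sqint unit_interval F = ennreal (sqnorm c)"
proof -
  let ?S = "sqnorm c"
  have [measurable]: "F \<in> borel_measurable unit_interval" "trig_poly c A \<in> borel_measurable unit_interval" for A
    using F by (auto intro: fourier_series_measurable' measurable_unit_interval)
  have approx: "sqint unit_interval F \<le> ennreal (1 + e) * ennreal ?S + ennreal (e\<^sup>2 + e)"
    "ennreal (?S - e\<^sup>2) \<le> ennreal (1 + e) * sqint unit_interval F + ennreal (e\<^sup>2 + e)" if e: "e > 0" for e
  proof -
    obtain E1 where E1: "finite E1" "\<And>A. finite A \<Longrightarrow> E1 \<subseteq> A \<Longrightarrow>
        sqint unit_interval (\<lambda>\<theta>. F \<theta> - trig_poly c A \<theta>) \<le> ennreal (e\<^sup>2)"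
      using fourier_series_approx[OF F, of "e\<^sup>2"] e by auto
    obtain E2 where E2: "finite E2" "dist (\<Sum>k\<in>E2. (cmod (c k))\<^sup>2) ?S \<le> e\<^sup>2"
      using infsum_finite_approximation[of "\<lambda>k. (cmod (c k))\<^sup>2" UNIV "e\<^sup>2"] c e
      by (auto simp: square_summable_def sqnorm_def)
    define A where "A = E1 \<union> E2"
    have A: "finite A" "E1 \<subseteq> A" "E2 \<subseteq> A" using E1 E2 by (auto simp: A_def)
    let ?P = "trig_poly c A"
    have P: "sqint unit_interval ?P = ennreal (\<Sum>k\<in>A. (cmod (c k))\<^sup>2)"
      by (rule sqint_trig_poly[OF A(1)])
    have d: "sqint unit_interval (\<lambda>\<theta>. F \<theta> - ?P \<theta>) \<le> ennreal (e\<^sup>2)"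
      by (rule E1(2)[OF A(1,2)])
    have "(1 + 1 / e) * e\<^sup>2 = e\<^sup>2 + e"
      using e by (simp add: power2_eq_square field_simps)
    then have ee: "ennreal (1 + 1 / e) * ennreal (e\<^sup>2) = ennreal (e\<^sup>2 + e)"
      using e by (subst ennreal_mult[symmetric]) auto
    have "sqint unit_interval (\<lambda>\<theta>. ?P \<theta> + (F \<theta> - ?P \<theta>)) \<le> ennreal (1 + e) * sqint unit_interval ?P +
        ennreal (1 + 1 / e) * sqint unit_interval (\<lambda>\<theta>. F \<theta> - ?P \<theta>)"
      by (rule sqint_add_le_weighted) (use e in auto)
    also have "\<dots> \<le> ennreal (1 + e) * ennreal ?S + ennreal (1 + 1 / e) * ennreal (e\<^sup>2)"
      unfolding P using d sum_le_sqnorm[OF c A(1)] by (intro add_mono mult_left_mono ennreal_leI) auto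
    finally show "sqint unit_interval F \<le> ennreal (1 + e) * ennreal ?S + ennreal (e\<^sup>2 + e)"
      unfolding ee by simp
    have "(\<Sum>k\<in>E2. (cmod (c k))\<^sup>2) \<le> (\<Sum>k\<in>A. (cmod (c k))\<^sup>2)"
      using A by (intro sum_mono2) auto
    then have "ennreal (?S - e\<^sup>2) \<le> sqint unit_interval ?P"
      unfolding P using E2(2) by (intro ennreal_leI) (auto simp: dist_real_def)
    also have "\<dots> = sqint unit_interval (\<lambda>\<theta>. F \<theta> + (?P \<theta> - F \<theta>))" by simp
    also have "\<dots> \<le> ennreal (1 + e) * sqint unit_interval F +
        ennreal (1 + 1 / e) * sqint unit_interval (\<lambda>\<theta>. ?P \<theta> - F \<theta>)"
      by (rule sqint_add_le_weighted) (use e in auto)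
    also have "\<dots> \<le> ennreal (1 + e) * sqint unit_interval F + ennreal (1 + 1 / e) * ennreal (e\<^sup>2)"
      using d unfolding sqint_minus_commute[of _ ?P] by (intro add_mono mult_left_mono) auto
    finally show "ennreal (?S - e\<^sup>2) \<le> ennreal (1 + e) * sqint unit_interval F + ennreal (e\<^sup>2 + e)"
      unfolding ee .
  qed
  have "sqint unit_interval F < \<infinity>"
    using approx(1)[of 1] by (rule order.strict_trans1) (auto simp: ennreal_mult_less_top)
  then obtain x where x: "sqint unit_interval F = ennreal x" "x \<ge> 0"
    by (cases "sqint unit_interval F") auto
  have 1: "x \<le> (1 + e) * ?S + (e\<^sup>2 + e)" if e: "e > 0" for e
  proof -
    have "ennreal x \<le> ennreal ((1 + e) * ?S + (e\<^sup>2 + e))"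
      using approx(1)[OF e] e x by (simp add: ennreal_mult)
    then show ?thesis using e by (subst (asm) ennreal_le_iff) auto
  qed
  have 2: "?S - e\<^sup>2 \<le> (1 + e) * x + (e\<^sup>2 + e)" if e: "e > 0" for e
  proof -
    have "ennreal (?S - e\<^sup>2) \<le> ennreal ((1 + e) * x + (e\<^sup>2 + e))"
      using approx(2)[OF e] e x by (simp add: ennreal_mult)
    then show ?thesis using e x(2) by (subst (asm) ennreal_le_iff) auto
  qed
  have lim: "(\<lambda>n. inverse (real (Suc n))) \<longlonglongrightarrow> 0"
    by (rule LIMSEQ_inverse_real_of_nat)
  have "x \<le> (1 + 0) * ?S + (0\<^sup>2 + 0)"
    by (rule LIMSEQ_le_const[where X = "\<lambda>n. (1 + inverse (real (Suc n))) * ?S +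
          ((inverse (real (Suc n)))\<^sup>2 + inverse (real (Suc n)))"])
      (intro tendsto_intros lim, use 1 in auto)
  moreover have "?S - 0\<^sup>2 - (0\<^sup>2 + 0) \<le> (1 + 0) * x"
    by (rule LIMSEQ_le[where X = "\<lambda>n. ?S - (inverse (real (Suc n)))\<^sup>2 -
          ((inverse (real (Suc n)))\<^sup>2 + inverse (real (Suc n)))" and
          Y = "\<lambda>n. (1 + inverse (real (Suc n))) * x"])
      (intro tendsto_intros lim, intro tendsto_intros lim,
        use 2[of "inverse (real (Suc n))" for n] in \<open>auto simp: algebra_simps\<close>)
  ultimately show ?thesis using x by simp
qed

lemma fourier_series_zero_AE:
  assumes "fourier_series (\<lambda>k. 0) F"
  shows "AE \<theta> in unit_interval. F \<theta> = 0"
  using sqint_fourier_series[OF assms] sqint_eq_0_iff[OF fourier_series_measurable'[OF assms]]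
  by (simp add: sqnorm_def)

lemma fourier_series_coeff_eq_0:
  assumes F: "fourier_series c F" and c: "square_summable c"
    and 0: "AE \<theta> in unit_interval. F \<theta> = 0"
  shows "c k = 0"
proof -
  have "ennreal (sqnorm c) = 0"
    using sqint_fourier_series[OF F c] sqint_eq_0_iff[OF fourier_series_measurable'[OF F]] 0 by simp
  then have "sqnorm c = 0"
    using sqnorm_nonneg[of c] by (simp add: ennreal_eq_0_iff)
  then show ?thesis using coord_le_sqnorm[OF c, of k] by simp
qed

lemma fourier_series_has_integral_sq:
  assumes F: "fourier_series c F" and c: "square_summable c"
  shows "has_bochner_integral unit_interval (\<lambda>\<theta>. complex_of_real ((cmod (F \<theta>))\<^sup>2)) (of_real (sqnorm c))"
proof (rule has_bochner_integral_of_real, rule has_bochner_integral_nn_integral)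
  show "(\<integral>\<^sup>+\<theta>. ennreal ((cmod (F \<theta>))\<^sup>2) \<partial>unit_interval) = ennreal (sqnorm c)"
    using sqint_fourier_series[OF F c] by (simp add: sqint_def)
qed (use fourier_series_measurable'[OF F] in auto)

lemma polarization:
  "a * cnj b = (of_real ((cmod (a + b))\<^sup>2) - of_real ((cmod (a - b))\<^sup>2) +
    \<i> * (of_real ((cmod (a + \<i> * b))\<^sup>2) - of_real ((cmod (a - \<i> * b))\<^sup>2))) / 4"
  by (simp add: complex_eq_iff cmod_power2) (simp add: power2_eq_square algebra_simps)

lemma inprod_polarization:
  assumes "square_summable c" "square_summable d"
  shows "inprod c d = (of_real (sqnorm (\<lambda>k. c k + d k)) - of_real (sqnorm (\<lambda>k. c k - d k)) +
    \<i> * (of_real (sqnorm (\<lambda>k. c k + \<i> * d k)) - of_real (sqnorm (\<lambda>k. c k - \<i> * d k)))) / 4"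
  using sqnorm_diff_scale[OF assms, of 1] sqnorm_diff_scale[OF assms, of "- 1"]
    sqnorm_diff_scale[OF assms, of \<i>] sqnorm_diff_scale[OF assms, of "- \<i>"]
  by (simp add: complex_eq_iff)

text \<open>Polarization on both sides reduces the claim to four instances of Parseval's identity.
  Stating it with \<open>has_bochner_integral\<close> delivers integrability of the product together
  with its value.\<close>

lemma fourier_series_inprod:
  assumes F: "fourier_series c F" and G: "fourier_series d G"
    and c: "square_summable c" and d: "square_summable d"
  shows "has_bochner_integral unit_interval (\<lambda>\<theta>. F \<theta> * cnj (G \<theta>)) (inprod c d)"
proof -
  have iG: "fourier_series (\<lambda>k. \<i> * d k) (\<lambda>\<theta>. \<i> * G \<theta>)" and id: "square_summable (\<lambda>k. \<i> * d k)"
    using G d by (auto intro: fourier_series_scale square_summable_scale)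
  show ?thesis
    unfolding polarization[of "F _"] inprod_polarization[OF c d]
    by (intro has_bochner_integral_divide has_bochner_integral_add has_bochner_integral_diff
        has_bochner_integral_mult_right fourier_series_has_integral_sq
        fourier_series_add fourier_series_diff square_summable_add square_summable_diff F G iG c d id)
qed

section \<open>Uniqueness of Fourier coefficients\<close>

text \<open>
  A function with vanishing Fourier coefficients is orthogonal to the powers of \<open>bump b\<close>, which are
  trigonometric polynomials, hence by Weierstrass to every continuous function of \<open>bump b\<close>, and in the limit to
  the indicator of \<open>{\<theta>. bump b \<theta> > 0}\<close>, which on \<open>[0,1)\<close> is the interval \<open>(0,b)\<close>.
\<close>

definition bump :: "real \<Rightarrow> real \<Rightarrow> real" where
  "bump b \<theta> = 2 * (sin (pi * \<theta>) * sin (pi * (b - \<theta>)))"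

lemma bump_abs_le: "\<bar>bump b \<theta>\<bar> \<le> 2"
proof -
  have "\<bar>sin (pi * \<theta>)\<bar> * \<bar>sin (pi * (b - \<theta>))\<bar> \<le> 1 * 1"
    by (intro mult_mono) auto
  then show ?thesis by (simp add: bump_def abs_mult)
qed

text \<open>For \<open>0 < \<theta> < 1\<close> the first sine is positive, so the sign is that of
  the second one, which changes at \<open>b\<close>; at \<open>\<theta> = 0\<close> the product
  vanishes.\<close>

lemma bump_pos_iff:
  assumes "0 < b" "b \<le> 1" "0 \<le> \<theta>" "\<theta> < 1"
  shows "bump b \<theta> > 0 \<longleftrightarrow> 0 < \<theta> \<and> \<theta> < b"
proof (cases "0 < \<theta> \<and> \<theta> < b")
  case True
  have "sin (pi * \<theta>) > 0"
    using True assms by (intro sin_gt_zero) auto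
  moreover have "sin (pi * (b - \<theta>)) > 0"
    using True assms by (intro sin_gt_zero) (auto simp: pos_less_divide_eq)
  ultimately show ?thesis using True by (simp add: bump_def)
next
  case False
  have "bump b \<theta> \<le> 0"
  proof (cases "\<theta> = 0")
    case neq: False
    have "sin (pi * \<theta>) \<ge> 0"
      using assms by (intro sin_ge_zero) auto
    moreover have "sin (pi * (\<theta> - b)) \<ge> 0"
      using False neq assms by (intro sin_ge_zero) auto
    moreover have "sin (pi * (b - \<theta>)) = - sin (pi * (\<theta> - b))"
      by (simp flip: sin_minus add: algebra_simps)
    ultimately show ?thesis by (simp add: bump_def)
  qed (simp add: bump_def)
  with False show ?thesis by simp
qed

text \<open>The product formula turns the two sines into
  \<open>cos (2 * pi * \<theta> - pi * b) - cos (pi * b)\<close>, so only the frequencies -1, 0 and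
  1 occur; the factor 2 in \<open>bump\<close> cancels the one half of that formula.\<close>

lemma bump_eq:
  "complex_of_real (bump b \<theta>) =
    exp (- \<i> * of_real (pi * b)) / 2 * fexp 1 \<theta> + exp (\<i> * of_real (pi * b)) / 2 * fexp (- 1) \<theta>
      - of_real (cos (pi * b))"
proof -
  have "bump b \<theta> = cos (pi * \<theta> - pi * (b - \<theta>)) - cos (pi * \<theta> + pi * (b - \<theta>))"
    unfolding bump_def cos_diff cos_add by simp
  also have "\<dots> = cos (2 * pi * \<theta> - pi * b) - cos (pi * b)"
    by (simp add: algebra_simps)
  finally have 1: "bump b \<theta> = cos (2 * pi * \<theta> - pi * b) - cos (pi * b)" .
  have 2: "complex_of_real (cos x) = (exp (\<i> * of_real x) + exp (- \<i> * of_real x)) / 2" for x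
    by (simp add: cos_of_real[symmetric] cos_exp_eq)
  have "complex_of_real (cos (2 * pi * \<theta> - pi * b)) =
     exp (- \<i> * of_real (pi * b)) / 2 * fexp 1 \<theta> + exp (\<i> * of_real (pi * b)) / 2 * fexp (- 1) \<theta>"
    unfolding 2 fexp_def by (simp add: add_divide_distrib flip: exp_add) (simp add: algebra_simps)
  then show ?thesis using 1 by simp
qed

lemma continuous_bump: "continuous_on A (bump b)"
  unfolding bump_def[abs_def] by (intro continuous_intros)

lemma borel_measurable_bump [measurable]: "bump b \<in> borel_measurable borel"
  by (intro borel_measurable_continuous_onI continuous_bump)

lemma integrable_mult_bounded:
  fixes f g :: "'a \<Rightarrow> complex"
  assumes "integrable M f" and [measurable]: "g \<in> borel_measurable M" and g: "\<And>x. cmod (g x) \<le> B"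
  shows "integrable M (\<lambda>x. f x * g x)"
proof (rule Bochner_Integration.integrable_bound)
  show "integrable M (\<lambda>x. of_real B * f x)"
    using assms(1) by simp
  have [measurable]: "f \<in> borel_measurable M" using assms(1) by simp
  show "(\<lambda>x. f x * g x) \<in> borel_measurable M" by measurable
  have "cmod (f x * g x) \<le> cmod (of_real B * f x)" for x
    using mult_left_mono[OF order_trans[OF g[of x] abs_ge_self], of "cmod (f x)"]
    by (simp add: norm_mult mult.commute)
  then show "AE x in M. cmod (f x * g x) \<le> cmod (of_real B * f x)" by simp
qed

context
  fixes \<phi> :: "real \<Rightarrow> complex"
  assumes \<phi>: "integrable unit_interval \<phi>"
    and coeff: "\<And>t. (\<integral>\<theta>. \<phi> \<theta> * fexp t \<theta> \<partial>unit_interval) = 0"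
begin

text \<open>Each factor \<open>bump b\<close> moves the frequency by at most one, so the induction
  has to carry an arbitrary \<open>fexp t\<close> along.\<close>

lemma integral_bump_power:
  "(\<integral>\<theta>. \<phi> \<theta> * (of_real (bump b \<theta> ^ k) * fexp t \<theta>) \<partial>unit_interval) = 0"
proof (induction k arbitrary: t)
  case 0
  then show ?case using coeff by simp
next
  case (Suc k)
  have int: "integrable unit_interval (\<lambda>\<theta>. \<phi> \<theta> * (of_real (bump b \<theta> ^ k) * fexp t \<theta>))" for t
  proof (rule integrable_mult_bounded[OF \<phi>])
    show "(\<lambda>\<theta>. complex_of_real (bump b \<theta> ^ k) * fexp t \<theta>) \<in> borel_measurable unit_interval"
      by (rule measurable_unit_interval) measurable
    show "cmod (complex_of_real (bump b \<theta> ^ k) * fexp t \<theta>) \<le> 2 ^ k" for \<theta>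
      using power_mono[OF bump_abs_le[of b \<theta>], of k] by (simp add: norm_mult power_abs norm_power)
  qed
  define u where "u = exp (- \<i> * of_real (pi * b)) / 2"
  define w where "w = exp (\<i> * of_real (pi * b)) / 2"
  define v where "v = complex_of_real (cos (pi * b))"
  have eq: "\<phi> \<theta> * (of_real (bump b \<theta> ^ Suc k) * fexp t \<theta>) =
      u * (\<phi> \<theta> * (of_real (bump b \<theta> ^ k) * fexp (1 + t) \<theta>)) +
      w * (\<phi> \<theta> * (of_real (bump b \<theta> ^ k) * fexp (- 1 + t) \<theta>)) -
      v * (\<phi> \<theta> * (of_real (bump b \<theta> ^ k) * fexp t \<theta>))" for \<theta>
    unfolding power_Suc of_real_mult bump_eq fexp_add u_def v_def w_def by (simp add: algebra_simps)
  show ?case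
    unfolding eq by (simp add: int Suc.IH del: of_real_power)
qed

lemma integral_continuous_bump:
  assumes h: "continuous_on {-2..2} h"
  shows "(\<integral>\<theta>. \<phi> \<theta> * complex_of_real (h (bump b \<theta>)) \<partial>unit_interval) = 0"
proof -
  let ?I = "\<integral>\<theta>. \<phi> \<theta> * complex_of_real (h (bump b \<theta>)) \<partial>unit_interval"
  have inI: "bump b \<theta> \<in> {-2..2}" for \<theta>
    using bump_abs_le[of b \<theta>] by auto
  have cont: "continuous_on UNIV (\<lambda>\<theta>. h (bump b \<theta>))"
    by (rule continuous_on_compose2[OF h continuous_bump]) (use inI in auto)
  obtain B where "\<forall>y\<in>h ` {-2..2}. norm y \<le> B"
    using compact_imp_bounded[OF compact_continuous_image[OF h compact_Icc]]
    unfolding bounded_iff by blast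
  then have B: "\<bar>h x\<bar> \<le> B" if "x \<in> {-2..2}" for x
    using that by auto
  have inth: "integrable unit_interval (\<lambda>\<theta>. \<phi> \<theta> * complex_of_real (h (bump b \<theta>)))"
  proof (rule integrable_mult_bounded[OF \<phi>])
    show "(\<lambda>\<theta>. complex_of_real (h (bump b \<theta>))) \<in> borel_measurable unit_interval"
      using cont by (intro measurable_unit_interval borel_measurable_continuous_onI continuous_intros)
  qed (use B inI in auto)
  let ?N = "\<integral>\<theta>. cmod (\<phi> \<theta>) \<partial>unit_interval"
  have "cmod ?I \<le> e * ?N" if "e > 0" for e
  proof -
    obtain p where p: "real_polynomial_function p" "\<And>x. x \<in> {-2..2} \<Longrightarrow> \<bar>h x - p x\<bar> < e"
      using Stone_Weierstrass_real_polynomial_function[OF compact_Icc h \<open>e > 0\<close>] by blast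
    obtain a n where a: "p = (\<lambda>x. \<Sum>i\<le>n. a i * x ^ i)"
      using real_polynomial_function_imp_sum[OF p(1)] by blast
    have int: "integrable unit_interval (\<lambda>\<theta>. \<phi> \<theta> * of_real (bump b \<theta> ^ k))" for k
    proof (rule integrable_mult_bounded[OF \<phi>])
      show "(\<lambda>\<theta>. complex_of_real (bump b \<theta> ^ k)) \<in> borel_measurable unit_interval"
        by (rule measurable_unit_interval) measurable
      show "cmod (complex_of_real (bump b \<theta> ^ k)) \<le> 2 ^ k" for \<theta>
        using power_mono[OF bump_abs_le[of b \<theta>], of k] by (simp add: power_abs norm_power)
    qed
    have eq: "\<phi> \<theta> * complex_of_real (p (bump b \<theta>)) = (\<Sum>i\<le>n. of_real (a i) * (\<phi> \<theta> * of_real (bump b \<theta> ^ i)))" for \<theta>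
      unfolding a of_real_sum sum_distrib_left by (intro sum.cong) auto
    have intp: "integrable unit_interval (\<lambda>\<theta>. \<phi> \<theta> * complex_of_real (p (bump b \<theta>)))"
      unfolding eq by (intro Bochner_Integration.integrable_sum integrable_mult_right int)
    have "(\<integral>\<theta>. \<phi> \<theta> * complex_of_real (p (bump b \<theta>)) \<partial>unit_interval) = 0"
      unfolding eq using int integral_bump_power[of b _ 0] by simp
    then have "?I = (\<integral>\<theta>. \<phi> \<theta> * complex_of_real (h (bump b \<theta>)) - \<phi> \<theta> * complex_of_real (p (bump b \<theta>)) \<partial>unit_interval)"
      using inth intp by simp
    also have "cmod \<dots> \<le> (\<integral>\<theta>. cmod (\<phi> \<theta> * complex_of_real (h (bump b \<theta>)) - \<phi> \<theta> * complex_of_real (p (bump b \<theta>))) \<partial>unit_interval)"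
      by (rule integral_norm_bound)
    also have "\<dots> \<le> (\<integral>\<theta>. e * cmod (\<phi> \<theta>) \<partial>unit_interval)"
    proof (rule integral_mono)
      fix \<theta>
      have "cmod (\<phi> \<theta> * complex_of_real (h (bump b \<theta>)) - \<phi> \<theta> * complex_of_real (p (bump b \<theta>))) =
          cmod (\<phi> \<theta>) * \<bar>h (bump b \<theta>) - p (bump b \<theta>)\<bar>"
        by (simp add: norm_mult flip: right_diff_distrib of_real_diff)
      also have "\<dots> \<le> cmod (\<phi> \<theta>) * e"
        using p(2)[OF inI] by (intro mult_left_mono) (auto intro: less_imp_le)
      finally show "cmod (\<phi> \<theta> * complex_of_real (h (bump b \<theta>)) - \<phi> \<theta> * complex_of_real (p (bump b \<theta>))) \<le> e * cmod (\<phi> \<theta>)"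
        by (simp add: mult.commute)
    qed (use \<phi> inth intp in auto)
    finally show ?thesis by simp
  qed
  then have "cmod ?I \<le> inverse (real (Suc n)) * ?N" for n
    by simp
  moreover have "(\<lambda>n. inverse (real (Suc n)) * ?N) \<longlonglongrightarrow> 0 * ?N"
    by (intro tendsto_intros LIMSEQ_inverse_real_of_nat)
  ultimately have "cmod ?I \<le> 0 * ?N"
    by (intro LIMSEQ_le_const) auto
  then show ?thesis by simp
qed

lemma integral_initial_interval:
  assumes b: "0 < b" "b \<le> 1"
  shows "(\<integral>\<theta>. \<phi> \<theta> * indicator {0<..<b} \<theta> \<partial>unit_interval) = 0"
proof -
  \<comment> \<open>These continuous functions increase to the indicator of the positive reals and
    stay below one, so \<open>cmod (\<phi> \<theta>)\<close> dominates the integrands.\<close>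
  define h where "h n x = min 1 (real n * max 0 x)" for n x
  have h_bound: "\<bar>h n x\<bar> \<le> 1" for n x
    by (simp add: h_def)
  have cont: "continuous_on A (h n)" for A n
    unfolding h_def[abs_def] by (intro continuous_intros)
  have lim: "(\<lambda>n. h n x) \<longlonglongrightarrow> (if x > 0 then 1 else 0)" for x
  proof (cases "x > 0")
    case True
    obtain N where N: "1 < real N * x" using reals_Archimedean3[OF True] by blast
    have "h n x = 1" if "n \<ge> N" for n
    proof -
      have "1 \<le> real N * max 0 x" using N True by simp
      also have "\<dots> \<le> real n * max 0 x" using that by (intro mult_right_mono) auto
      finally show ?thesis unfolding h_def by (rule min_absorb1)
    qed
    then have "\<forall>\<^sub>F n in sequentially. h n x = 1"
      unfolding eventually_sequentially by blast
    then show ?thesis using True by (simp add: tendsto_eventually)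
  qed (simp add: h_def)
  have meas: "\<phi> \<in> borel_measurable unit_interval" using \<phi> by simp
  have "(\<lambda>n. \<integral>\<theta>. \<phi> \<theta> * complex_of_real (h n (bump b \<theta>)) \<partial>unit_interval)
      \<longlonglongrightarrow> (\<integral>\<theta>. \<phi> \<theta> * indicator {0<..<b} \<theta> \<partial>unit_interval)"
  proof (rule integral_dominated_convergence[where w = "\<lambda>\<theta>. cmod (\<phi> \<theta>)"])
    show "(\<lambda>\<theta>. \<phi> \<theta> * indicator {0<..<b} \<theta>) \<in> borel_measurable unit_interval"
      by (intro borel_measurable_times meas measurable_unit_interval) simp
    show "(\<lambda>\<theta>. \<phi> \<theta> * complex_of_real (h n (bump b \<theta>))) \<in> borel_measurable unit_interval" for n
      by (intro borel_measurable_times meas measurable_unit_interval borel_measurable_continuous_onI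
          continuous_intros continuous_on_compose2[OF cont[of UNIV] continuous_bump]) auto
    show "integrable unit_interval (\<lambda>\<theta>. cmod (\<phi> \<theta>))" using \<phi> by simp
    show "AE \<theta> in unit_interval. (\<lambda>n. \<phi> \<theta> * complex_of_real (h n (bump b \<theta>)))
        \<longlonglongrightarrow> \<phi> \<theta> * indicator {0<..<b} \<theta>"
    proof (rule AE_I2)
      fix \<theta> assume "\<theta> \<in> space unit_interval"
      then have "0 \<le> \<theta>" "\<theta> < 1" by (auto simp: space_restrict_space)
      then have "indicator {0<..<b} \<theta> = complex_of_real (if bump b \<theta> > 0 then 1 else 0)"
        using bump_pos_iff[OF b, of \<theta>] by (auto simp: indicator_def)
      then show "(\<lambda>n. \<phi> \<theta> * complex_of_real (h n (bump b \<theta>))) \<longlonglongrightarrow> \<phi> \<theta> * indicator {0<..<b} \<theta>"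
        using lim[of "bump b \<theta>"] by (simp only:) (intro tendsto_intros)
    qed
    show "AE \<theta> in unit_interval. cmod (\<phi> \<theta> * complex_of_real (h n (bump b \<theta>))) \<le> cmod (\<phi> \<theta>)" for n
      using mult_left_mono[OF h_bound, of "cmod (\<phi> _)"] by (simp add: norm_mult)
  qed
  then show ?thesis
    by (simp add: integral_continuous_bump[OF cont] LIMSEQ_const_iff)
qed

text \<open>Extended by zero to the real line, the function integrates to zero over every half-line
  \<open>{..a}\<close>. These form an intersection-stable generator of the Borel sets, and the sets
  with vanishing integral are closed under complements, by the coefficient at frequency zero, and
  under disjoint countable unions. So the integral vanishes over every Borel set.\<close>

lemma zero_Fourier_coefficients_AE_0: "AE \<theta> in unit_interval. \<phi> \<theta> = 0"
proof -
  define \<psi> where "\<psi> \<theta> = indicator {0..<1} \<theta> *\<^sub>R \<phi> \<theta>" for \<theta>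
  have \<psi>: "integrable lborel \<psi>"
    using \<phi> unfolding \<psi>_def[abs_def] by (subst (asm) integrable_restrict_space) auto
  have [measurable]: "\<psi> \<in> borel_measurable borel"
    using borel_measurable_integrable[OF \<psi>] by simp
  have int\<psi>: "set_integrable lborel A \<psi>" if "A \<in> sets borel" for A
    unfolding set_integrable_def using \<psi> that by (intro integrable_mult_indicator) auto
  have full: "(\<integral>\<theta>. \<psi> \<theta> \<partial>lborel) = 0"
    using coeff[of 0] unfolding \<psi>_def by (simp add: integral_restrict_space)
  have "set_lebesgue_integral lborel A \<psi> = 0" if A: "A \<in> sets lborel" for A
  proof -
    have stable: "Int_stable (range (\<lambda>a::real. {..a}))"
      by (auto simp: Int_stable_def)
    have borel: "sets borel = sigma_sets UNIV (range (\<lambda>a::real. {..a}))"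
      by (subst borel_eq_atMost) (rule sets_measure_of, simp)
    have "range (\<lambda>a::real. {..a}) \<subseteq> Pow UNIV" "A \<in> sigma_sets UNIV (range (\<lambda>a::real. {..a}))"
      using A borel by simp_all
    with stable show ?thesis
    proof (induction A rule: sigma_sets_induct_disjoint)
      case (basic A)
      then obtain a where A: "A = {..a}" by blast
      \<comment> \<open>A half-line reaching beyond 1 covers the whole unit interval, and one with
        \<open>a \<le> 0\<close> meets it at most in the null set \<open>{0}\<close>.\<close>
      define b where "b = min a 1"
      show ?case
      proof (cases "b > 0")
        case True
        have "set_lebesgue_integral lborel A \<psi> = (\<integral>\<theta>. indicator {0..<1} \<theta> *\<^sub>R (\<phi> \<theta> * indicator {0<..<b} \<theta>) \<partial>lborel)"
          unfolding set_lebesgue_integral_def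
        proof (rule integral_cong_AE)
          show "AE x in lborel. indicator A x *\<^sub>R \<psi> x = indicator {0..<1} x *\<^sub>R (\<phi> x * indicator {0<..<b} x)"
            using AE_lborel_singleton[of 0] AE_lborel_singleton[of b]
            by eventually_elim (auto simp: A \<psi>_def b_def indicator_def)
          have "(\<lambda>x. \<psi> x * indicator {0<..<b} x) \<in> borel_measurable lborel" by measurable
          then show "(\<lambda>x. indicator {0..<1} x *\<^sub>R (\<phi> x * indicator {0<..<b} x)) \<in> borel_measurable lborel"
            by (simp add: \<psi>_def)
        qed (simp add: A)
        also have "\<dots> = 0"
          using integral_initial_interval[OF True] by (simp add: integral_restrict_space b_def)
        finally show ?thesis .
      next
        case False
        show ?thesis
          unfolding set_lebesgue_integral_def
        proof (rule integral_eq_zero_AE)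
          show "AE x in lborel. indicator A x *\<^sub>R \<psi> x = 0"
            using AE_lborel_singleton[of 0] False
            by (auto elim!: eventually_mono simp: A \<psi>_def b_def indicator_def)
        qed
      qed
    next
      case (compl A)
      then have A: "A \<in> sets borel"
        unfolding borel by auto
      have "set_lebesgue_integral lborel (A \<union> (UNIV - A)) \<psi> =
          set_lebesgue_integral lborel A \<psi> + set_lebesgue_integral lborel (UNIV - A) \<psi>"
        using A by (intro set_integral_Un int\<psi>) auto
      moreover have "set_lebesgue_integral lborel (A \<union> (UNIV - A)) \<psi> = 0"
        using full by (simp add: set_lebesgue_integral_def Un_absorb2)
      ultimately show ?case using compl by simp
    next
      case (union A)
      then have A: "A i \<in> sets borel" for i
        unfolding borel by auto
      have "set_lebesgue_integral lborel (\<Union>i. A i) \<psi> = (\<Sum>i. set_lebesgue_integral lborel (A i) \<psi>)"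
        using A union(1) by (intro lebesgue_integral_countable_add int\<psi>)
          (auto simp: disjoint_family_on_def)
      then show ?case using union by simp
    qed (auto simp: set_lebesgue_integral_def)
  qed
  then have "AE \<theta> in lborel. \<psi> \<theta> = 0"
    by (rule sigma_finite_measure.density_zero[OF sigma_finite_lborel \<psi>])
  then show ?thesis
    unfolding AE_unit_interval by (rule AE_mp) (auto simp: \<psi>_def intro!: AE_I2)
qed

end

section \<open>Sequence spaces and the Zak transform\<close>

lemma square_summable_reindex:
  assumes f: "square_summable f" and inj: "inj \<phi>"
  shows "square_summable (\<lambda>x. f (\<phi> x))" and "sqnorm (\<lambda>x. f (\<phi> x)) \<le> sqnorm f"
proof -
  have le: "(\<Sum>x\<in>A. (cmod (f (\<phi> x)))\<^sup>2) \<le> sqnorm f" if "finite A" for A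
  proof -
    have "(\<Sum>x\<in>A. (cmod (f (\<phi> x)))\<^sup>2) = (\<Sum>y\<in>\<phi> ` A. (cmod (f y))\<^sup>2)"
      using inj by (subst sum.reindex) (auto intro: inj_on_subset)
    also have "\<dots> \<le> sqnorm f"
      using that by (intro sum_le_sqnorm f) simp
    finally show ?thesis .
  qed
  show "square_summable (\<lambda>x. f (\<phi> x))" by (rule square_summableI(1)[OF le])
  show "sqnorm (\<lambda>x. f (\<phi> x)) \<le> sqnorm f" by (rule square_summableI(2)[OF le])
qed

lemma ell2_iff: "f \<in> ell2 S \<longleftrightarrow> square_summable f \<and> (\<forall>a. a \<notin> S \<longrightarrow> f a = 0)"
  by (simp add: ell2_def square_summable_def)

lemma ell2_vec_comp: "f \<in> ell2_vec S R \<Longrightarrow> square_summable (f r)"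
  by (cases "r < R") (auto simp: ell2_vec_def ell2_iff zero_fun_def)

lemma ell2_vec_outside: "f \<in> ell2_vec S R \<Longrightarrow> r \<ge> R \<or> a \<notin> S \<Longrightarrow> f r a = 0"
  by (cases "r < R") (auto simp: ell2_vec_def ell2_iff zero_fun_def)

lemma ell2_vecI:
  assumes "\<And>r. r < R \<Longrightarrow> square_summable (f r)" "\<And>r a. r < R \<Longrightarrow> a \<notin> S \<Longrightarrow> f r a = 0"
    "\<And>r. r \<ge> R \<Longrightarrow> f r = 0"
  shows "f \<in> ell2_vec S R"
  using assms by (auto simp: ell2_vec_def ell2_iff)

lemma subspace_ell2_vec: "seqs.subspace (ell2_vec S R)"
  unfolding seqs.subspace_def
  by (auto simp: ell2_vec_def ell2_iff seq_scale_def plus_fun_def zero_fun_def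
      intro: square_summable_add square_summable_scale)

lemma span_subset_ell2_vec: "X \<subseteq> ell2_vec S R \<Longrightarrow> seqs.span X \<subseteq> ell2_vec S R"
  by (rule seqs.span_minimal[OF _ subspace_ell2_vec])

lemma ell2_vec_diff: "f \<in> ell2_vec S R \<Longrightarrow> h \<in> ell2_vec S R \<Longrightarrow> f - h \<in> ell2_vec S R"
  by (rule seqs.subspace_diff[OF subspace_ell2_vec])

section \<open>Hilbert space structure and density in the vector-valued space\<close>

lemma ell2_vec_inner_eq_inprod: "ell2_vec_inner R f h = (\<Sum>r<R. inprod (f r) (h r))"
  by (simp add: ell2_vec_inner_def ell2_inner_def inprod_def)

lemma inprod_self: "square_summable f \<Longrightarrow> inprod f f = of_real (sqnorm f)"
  unfolding inprod_def sqnorm_def complex_norm_square[symmetric] square_summable_def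
  by (intro infsumI has_sum_of_real has_sum_infsum)

lemma ell2_vec_norm_eq:
  assumes f: "f \<in> ell2_vec S R"
  shows "ell2_vec_norm R f = sqrt (\<Sum>r<R. sqnorm (f r))"
  unfolding ell2_vec_norm_def ell2_vec_inner_eq_inprod
  using f by (simp add: inprod_self ell2_vec_comp)

lemma ell2_vec_norm_sq: "f \<in> ell2_vec S R \<Longrightarrow> (ell2_vec_norm R f)\<^sup>2 = (\<Sum>r<R. sqnorm (f r))"
  by (simp add: ell2_vec_norm_eq sum_nonneg)

lemma ell2_vec_norm_nonneg: "f \<in> ell2_vec S R \<Longrightarrow> 0 \<le> ell2_vec_norm R f"
  by (simp add: ell2_vec_norm_eq sum_nonneg)

text \<open>A vector of sequences becomes one square-summable family on pairs, so projection
  arguments for scalar families apply. The vanishing of components from \<open>R\<close> on turns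
  the sum over all pairs into a finite sum of series.\<close>

lemma ell2_vec_uncurry:
  assumes f: "f \<in> ell2_vec S R" and h: "h \<in> ell2_vec S R"
  shows "square_summable (case_prod f)" and "inprod (case_prod f) (case_prod h) = ell2_vec_inner R f h"
    and "sqnorm (case_prod f) = (\<Sum>r<R. sqnorm (f r))"
proof -
  have out: "f r a = 0" "h r a = 0" if "r \<ge> R" for r a
    using f h that by (auto simp: ell2_vec_def zero_fun_def)
  have eq: "(\<Union>r<R. (\<lambda>a. (r, a)) ` UNIV) = {..<R} \<times> UNIV" by auto
  have sum: "(u has_sum (\<Sum>r<R. s r)) (UNIV :: (nat \<times> int) set)"
    if "\<And>r. r < R \<Longrightarrow> ((\<lambda>a. u (r, a)) has_sum s r) UNIV" "\<And>r a. r \<ge> R \<Longrightarrow> u (r, a) = 0"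
    for u :: "nat \<times> int \<Rightarrow> 'c::topological_comm_monoid_add" and s
  proof -
    have "(u has_sum s r) ((\<lambda>a. (r, a)) ` UNIV)" if "r < R" for r
      using \<open>\<And>r. r < R \<Longrightarrow> ((\<lambda>a. u (r, a)) has_sum s r) UNIV\<close>[OF that]
      by (subst has_sum_reindex) (auto simp: inj_on_def o_def)
    then have "(u has_sum (\<Sum>r<R. s r)) ({..<R} \<times> UNIV)"
      unfolding eq[symmetric] by (intro sum_has_sum) auto
    moreover have "u x = 0" if "x \<in> UNIV - {..<R} \<times> UNIV" for x
      using that \<open>\<And>r a. r \<ge> R \<Longrightarrow> u (r, a) = 0\<close> by (cases x) simp
    ultimately show ?thesis
      by (subst has_sum_cong_neutral[where T = "{..<R} \<times> UNIV" and g = u]) auto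
  qed
  have "((\<lambda>x. (cmod (case_prod f x))\<^sup>2) has_sum (\<Sum>r<R. sqnorm (f r))) UNIV"
    using ell2_vec_comp[OF f] by (intro sum) (auto simp: out sqnorm_def square_summable_def)
  then show "square_summable (case_prod f)" "sqnorm (case_prod f) = (\<Sum>r<R. sqnorm (f r))"
    by (auto simp: square_summable_def sqnorm_def summable_on_def intro: infsumI)
  have "((\<lambda>x. case_prod f x * cnj (case_prod h x)) has_sum (\<Sum>r<R. inprod (f r) (h r))) UNIV"
    using square_summable_prod[OF ell2_vec_comp[OF f] ell2_vec_comp[OF h]]
    by (intro sum) (auto simp: out inprod_def)
  then show "inprod (case_prod f) (case_prod h) = ell2_vec_inner R f h"
    by (simp add: ell2_vec_inner_eq_inprod inprod_def infsumI)
qed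

text \<open>The component of \<open>f\<close> orthogonal to the span lies in the space again and is
  orthogonal to \<open>X\<close>, hence is zero. Its defining minimizing sequence therefore
  converges to \<open>f\<close>.\<close>

lemma closed_span_eq_ell2_vec:
  assumes X: "X \<subseteq> ell2_vec S R"
    and orth: "\<And>w. w \<in> ell2_vec S R \<Longrightarrow> (\<And>x. x \<in> X \<Longrightarrow> ell2_vec_inner R w x = 0) \<Longrightarrow> w = 0"
  shows "closed_span_in S R X = ell2_vec S R"
proof
  show "closed_span_in S R X \<subseteq> ell2_vec S R" by (auto simp: closed_span_in_def)
  show "ell2_vec S R \<subseteq> closed_span_in S R X"
  proof
    fix f assume f: "f \<in> ell2_vec S R"
    define V where "V = case_prod ` seqs.span X"
    note span = span_subset_ell2_vec[OF X, THEN subsetD]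
    have "case_prod 0 \<in> V" unfolding V_def by (intro imageI seqs.span_zero)
    then have ne: "V \<noteq> {}" by blast
    have sq: "square_summable h" if "h \<in> V" for h
      using that span ell2_vec_uncurry(1) unfolding V_def by blast
    have add: "(\<lambda>x. h x + k x) \<in> V" if hk: "h \<in> V" "k \<in> V" for h k
    proof -
      obtain h' k' where "h' \<in> seqs.span X" "k' \<in> seqs.span X" "h = case_prod h'" "k = case_prod k'"
        using hk by (auto simp: V_def)
      moreover from this have "(\<lambda>x. h x + k x) = case_prod (h' + k')"
        by (auto simp: fun_eq_iff)
      ultimately show ?thesis unfolding V_def by (auto intro: seqs.span_add)
    qed
    have scale: "(\<lambda>x. c * h x) \<in> V" if h: "h \<in> V" for c h
    proof -
      obtain h' where "h' \<in> seqs.span X" "h = case_prod h'" using h by (auto simp: V_def)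
      moreover from this have "(\<lambda>x. c * h x) = case_prod (seq_scale c h')"
        by (auto simp: fun_eq_iff seq_scale_def)
      ultimately show ?thesis unfolding V_def by (auto intro: seqs.span_scale)
    qed
    show "f \<in> closed_span_in S R X"
    proof (rule orthogonal_component[OF ell2_vec_uncurry(1)[OF f f] sq ne add scale])
      fix h w assume h: "\<And>n. h n \<in> V" and w: "square_summable w"
        and lim: "\<And>x. (\<lambda>n. case_prod f x - h n x) \<longlonglongrightarrow> w x"
        and norm: "(\<lambda>n. sqnorm (\<lambda>x. case_prod f x - h n x - w x)) \<longlonglongrightarrow> 0"
        and perp: "\<And>y. y \<in> V \<Longrightarrow> inprod w y = 0"
      obtain h' where h': "\<And>n. h' n \<in> seqs.span X" "\<And>n. h n = case_prod (h' n)"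
      proof -
        have "\<exists>k. k \<in> seqs.span X \<and> h n = case_prod k" for n
          using h[of n] by (auto simp: V_def)
        then have "\<forall>n. \<exists>k. k \<in> seqs.span X \<and> h n = case_prod k" by blast
        from choice[OF this] show thesis using that by blast
      qed
      \<comment> \<open>The zeros outside \<open>S\<close> and beyond \<open>R\<close> pass to
        \<open>w\<close> through pointwise convergence, which is why the projection lemma supplies
        it beside norm convergence.\<close>
      have w0: "w (r, a) = 0" if "r \<ge> R \<or> a \<notin> S" for r a
      proof -
        have "f r a = 0" "h' n r a = 0" for n
          using ell2_vec_outside[OF f that] ell2_vec_outside[OF span[OF h'(1)] that] by auto
        then show ?thesis using lim[of "(r, a)"] by (simp add: h' LIMSEQ_const_iff)
      qed
      have curry: "curry w \<in> ell2_vec S R"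
      proof (rule ell2_vecI)
        show "square_summable (curry w r)" for r
          using square_summable_reindex(1)[OF w, of "\<lambda>a. (r, a)"] by (simp add: inj_on_def curry_def)
      qed (auto simp: w0 fun_eq_iff)
      have "curry w = 0"
      proof (rule orth[OF curry])
        fix x assume "x \<in> X"
        then have x: "x \<in> seqs.span X" "x \<in> ell2_vec S R" using X by (auto intro: seqs.span_base)
        show "ell2_vec_inner R (curry w) x = 0"
          using perp[of "case_prod x"] x ell2_vec_uncurry(2)[OF curry x(2)] by (simp add: V_def)
      qed
      then have w_eq: "w = (\<lambda>x. 0)" by (auto simp: fun_eq_iff)
      have "\<exists>h\<in>seqs.span X. ell2_vec_norm R (f - h) < \<epsilon>" if "\<epsilon> > 0" for \<epsilon>
      proof -
        have "\<forall>\<^sub>F n in sequentially. sqnorm (\<lambda>x. case_prod f x - h n x - w x) < \<epsilon>\<^sup>2"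
          using norm by (rule order_tendstoD) (use that in simp)
        then obtain n where n: "sqnorm (\<lambda>x. case_prod f x - h n x - w x) < \<epsilon>\<^sup>2"
          using eventually_happens' by force
        have d: "f - h' n \<in> ell2_vec S R" by (intro ell2_vec_diff f span h')
        have "(ell2_vec_norm R (f - h' n))\<^sup>2 = sqnorm (case_prod (f - h' n))"
          using ell2_vec_norm_sq[OF d] ell2_vec_uncurry(3)[OF d d] by simp
        also have "case_prod (f - h' n) = (\<lambda>x. case_prod f x - h n x - w x)"
          by (auto simp: fun_eq_iff h' w_eq)
        also note n
        finally have "ell2_vec_norm R (f - h' n) < \<epsilon>"
          by (rule power2_less_imp_less) (use that in simp)
        then show ?thesis using h'(1) by blast
      qed
      then show "f \<in> closed_span_in S R X" using f by (simp add: closed_span_in_def)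
    qed
  qed
qed

text \<open>Existence of some limit makes the choice in \<open>zak\<close> meaningful. Afterwards
  only the relation \<open>fourier_series\<close> is used, never a particular
  representative.\<close>

lemma zak_fourier_series:
  assumes h: "square_summable h" and K: "K \<ge> 1"
  shows "fourier_series (\<lambda>u. h (a + u * int K)) (zak K h a)"
proof -
  have "inj (\<lambda>u. a + u * int K)" using K by (auto simp: inj_on_def)
  then obtain F where "fourier_series (\<lambda>u. h (a + u * int K)) F"
    using fourier_series_exists[OF square_summable_reindex(1)[OF h]] by blast
  then have "is_zak K h a F" by (simp add: is_zak_iff)
  then have "is_zak K h a (zak K h a)" unfolding zak_def by (rule someI[where P = "is_zak K h a"])
  then show ?thesis by (simp add: is_zak_iff)
qed

lemma zak_matrix_sys_index:
  assumes "i < q * L" "c < p * R"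
  shows "zak_matrix_sys L M N p q R g j \<theta> $$ (i, c) =
    zak (p * M) (g (i div q) (c div p)) (j + int (c mod p) * int M - int (i mod q) * int N) \<theta>"
proof -
  have "q > 0" "p > 0" using assms by (auto intro: Nat.gr0I)
  then show ?thesis
    using assms by (simp add: zak_matrix_sys_def zak_matrix_vec_def zak_matrix_def)
qed

lemma sum_div_mod:
  fixes f :: "nat \<Rightarrow> nat \<Rightarrow> 'a::comm_monoid_add"
  assumes "p > 0"
  shows "(\<Sum>c<p * R. f (c div p) (c mod p)) = (\<Sum>r<R. \<Sum>k<p. f r k)"
proof -
  have "r * p + k < p * R" if "r < R" "k < p" for r k
  proof -
    have "r * p + k < Suc r * p" using that by simp
    also have "\<dots> \<le> R * p" using that by (intro mult_right_mono) auto
    finally show ?thesis by (simp add: mult.commute)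
  qed
  then show ?thesis
    unfolding sum.cartesian_product
    using assms
    by (intro sum.reindex_bij_witness[of _ "\<lambda>(r, k). r * p + k" "\<lambda>c. (c div p, c mod p)"])
      (auto simp: less_mult_imp_div_less mult.commute)
qed

section \<open>Gabor systems\<close>

lemma infsum_finite_sum:
  fixes f :: "'i \<Rightarrow> 'x \<Rightarrow> complex"
  assumes "finite I" "\<And>i. i \<in> I \<Longrightarrow> f i summable_on A"
  shows "(\<Sum>\<^sub>\<infinity>x\<in>A. \<Sum>i\<in>I. f i x) = (\<Sum>i\<in>I. \<Sum>\<^sub>\<infinity>x\<in>A. f i x)"
proof -
  have "((\<lambda>x. \<Sum>i\<in>I. f i x) has_sum (\<Sum>i\<in>I. \<Sum>\<^sub>\<infinity>x\<in>A. f i x)) A"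
    using assms by (induction I rule: finite_induct) (auto intro!: has_sum_add)
  then show ?thesis by (rule infsumI)
qed

lemma sum_roots_of_unity:
  assumes M: "M > 0"
  shows "(\<Sum>m<M. exp (2 * of_real pi * \<i> * of_real (real m / real M) * of_int d)) =
    (if int M dvd d then of_nat M else (0 :: complex))"
proof -
  define z where "z = exp (2 * of_real pi * \<i> * of_int d / of_nat M)"
  have pow: "exp (2 * of_real pi * \<i> * of_real (real m / real M) * of_int d) = z ^ m" for m
    by (simp add: z_def field_simps flip: exp_of_nat_mult)
  show ?thesis
  proof (cases "int M dvd d")
    case True
    then obtain e where "d = int M * e" by (elim dvdE)
    then have "z = exp (complex_of_real (2 * of_int e * pi) * \<i>)"
      using M by (simp add: z_def field_simps)
    also have "\<dots> = 1" using exp_integer_2pi[of "of_int e"] by simp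
    finally show ?thesis using True unfolding pow by simp
  next
    case False
    have "z \<noteq> 1"
    proof
      assume "z = 1"
      then obtain n :: int where "Im (2 * of_real pi * \<i> * of_int d / of_nat M) = of_int (2 * n) * pi"
        unfolding z_def exp_eq_1 by blast
      then have "real_of_int d = real_of_int n * real M"
        using M by (simp add: field_simps)
      then have "d = n * int M"
        by (metis of_int_eq_iff of_int_mult of_int_of_nat_eq)
      then show False using False by simp
    qed
    moreover have "z ^ M = exp (complex_of_real (2 * of_int d * pi) * \<i>)"
      using M by (simp add: z_def field_simps flip: exp_of_nat_mult)
    then have "z ^ M = 1" using exp_integer_2pi[of "of_int d"] by simp
    ultimately show ?thesis using False unfolding pow by (simp add: geometric_sum)
  qed
qed

text \<open>The number \<open>s\<close> is \<open>M/q\<close>, which equals \<open>N/p\<close> and,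
  by coprimality, the greatest common divisor of \<open>M\<close> and \<open>N\<close>. Expressing
  both through \<open>s\<close> keeps the arithmetic free of division.\<close>

locale gabor_setting =
  fixes L M N R p q s :: nat and S :: "int set" and g :: "nat \<Rightarrow> nat \<Rightarrow> int \<Rightarrow> complex"
  assumes M: "M = q * s" and N: "N = p * s" and pos: "p > 0" "q > 0" "s > 0"
    and coprime: "coprime p q"
    and periodic: "periodic_set N S"
    and g: "\<And>l. l < L \<Longrightarrow> g l \<in> ell2_vec S R"
begin

lemma periodic_iff: "a + n * int N \<in> S \<longleftrightarrow> a \<in> S"
proof
  assume "a + n * int N \<in> S"
  then have "a + n * int N + (- n) * int N \<in> S"
    using periodic unfolding periodic_set_def by blast
  then show "a \<in> S" by simp
qed (use periodic in \<open>auto simp: periodic_set_def\<close>)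

lemma periodic_diff_iff: "a - n * int N \<in> S \<longleftrightarrow> a \<in> S"
  using periodic_iff[of a "- n"] by simp

lemma translation_ell2_vec:
  assumes f: "f \<in> ell2_vec S R"
  shows "translation (n * int N) f \<in> ell2_vec S R"
proof (rule ell2_vecI)
  show "square_summable (translation (n * int N) f r)" for r
    unfolding translation_def by (rule square_summable_reindex[OF ell2_vec_comp[OF f]]) (simp add: inj_on_def)
  show "translation (n * int N) f r a = 0" if "a \<notin> S" for r a
    unfolding translation_def by (rule ell2_vec_outside[OF f]) (use that in \<open>simp add: periodic_diff_iff\<close>)
  show "translation (n * int N) f r = 0" if "r \<ge> R" for r
    using ell2_vec_outside[OF f, of r] that by (auto simp: translation_def fun_eq_iff)
qed

lemma modulation_ell2_vec:
  assumes f: "f \<in> ell2_vec S R"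
  shows "modulation a f \<in> ell2_vec S R"
proof (rule ell2_vecI)
  have "norm (exp (2 * of_real pi * \<i> * of_real a * of_int j)) = (1 :: real)" for j :: int
    by (simp add: norm_exp_eq_Re)
  then show "square_summable (modulation a f r)" for r
    using ell2_vec_comp[OF f, of r] by (simp add: square_summable_def modulation_def norm_mult)
  show "modulation a f r b = 0" if "b \<notin> S" for r b
    using ell2_vec_outside[OF f, of r b] that by (simp add: modulation_def)
  show "modulation a f r = 0" if "r \<ge> R" for r
    using ell2_vec_outside[OF f, of r] that by (auto simp: modulation_def fun_eq_iff)
qed

lemma gabor_system_subset: "gabor_system g L M N \<subseteq> ell2_vec S R"
  unfolding gabor_system_def using g by (auto intro: modulation_ell2_vec translation_ell2_vec)

section \<open>Entries of the Zak matrix and their Fourier coefficients\<close>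

text \<open>
  A row \<open>i\<close> of the matrix stands for the generator \<open>i div q\<close> and the translation index \<open>i mod q\<close>, a
  column \<open>c\<close> for the component \<open>c div p\<close> and the residue \<open>c mod p\<close>. \<open>zc j i c\<close> are the Fourier
  coefficients of the entry \<open>Z j i c\<close>, and \<open>fc f j c\<close> those of the entry of the row belonging to \<open>f\<close>.
\<close>

definition Z :: "int \<Rightarrow> nat \<Rightarrow> nat \<Rightarrow> real \<Rightarrow> complex" where
  "Z j i c = zak (p * M) (g (i div q) (c div p)) (j + int (c mod p) * int M - int (i mod q) * int N)"

definition zc :: "int \<Rightarrow> nat \<Rightarrow> nat \<Rightarrow> int \<Rightarrow> complex" where
  "zc j i c u = g (i div q) (c div p) (j + int (c mod p) * int M - int (i mod q) * int N + u * int (p * M))"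

definition fc :: "(nat \<Rightarrow> int \<Rightarrow> complex) \<Rightarrow> int \<Rightarrow> nat \<Rightarrow> int \<Rightarrow> complex" where
  "fc f j c u = f (c div p) (j + int (c mod p) * int M + u * int (p * M))"

definition cols :: "int \<Rightarrow> nat set" where
  "cols j = {c. c < p * R \<and> c mod p \<in> K_set S M p j}"

lemma finite_cols: "finite (cols j)" and cols_subset: "cols j \<subseteq> {..<p * R}"
  by (auto simp: cols_def)

lemma card_cols: "card (cols j) = R * card (K_set S M p j)"
proof -
  have "finite (K_set S M p j)" by (simp add: K_set_def)
  have "card (cols j) = (\<Sum>c<p * R. if c mod p \<in> K_set S M p j then 1 else 0)"
    by (simp add: cols_def sum.If_cases Int_def)
  also have "\<dots> = (\<Sum>r<R. \<Sum>k<p. if k \<in> K_set S M p j then 1 else 0)"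
    using sum_div_mod[where p = p and R = R and f = "\<lambda>r k. if k \<in> K_set S M p j then 1 else (0::nat)"] pos
    by simp
  also have "(\<Sum>k<p. if k \<in> K_set S M p j then 1 else 0) = card (K_set S M p j)"
    by (simp add: sum.If_cases K_set_def Int_def conj_commute)
  finally show ?thesis by simp
qed

lemma pM_pos: "p * M \<ge> 1"
  using M pos by simp

lemma qN_eq: "q * N = p * M"
  by (simp add: M N)

lemma row_less: "i < q * L \<Longrightarrow> i div q < L"
  by (simp add: less_mult_imp_div_less mult.commute)

lemma inj_period: "inj (\<lambda>u. a + u * int (p * M))"
  using pM_pos by (auto simp: inj_on_def)

lemma fourier_series_Z:
  assumes "i < q * L"
  shows "fourier_series (zc j i c) (Z j i c)"
  unfolding zc_def[abs_def] Z_def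
  by (intro zak_fourier_series ell2_vec_comp[OF g] row_less assms pM_pos)

lemma square_summable_zc: "i < q * L \<Longrightarrow> square_summable (zc j i c)"
  unfolding zc_def[abs_def]
  by (intro square_summable_reindex(1)[of _ "\<lambda>u. _ + u * int (p * M)"] ell2_vec_comp[OF g] row_less inj_period)

lemma square_summable_fc:
  assumes "f \<in> ell2_vec S R"
  shows "square_summable (fc f j c)" and "sqnorm (fc f j c) \<le> sqnorm (f (c div p))"
  using square_summable_reindex[OF ell2_vec_comp[OF assms] inj_period] unfolding fc_def[abs_def] by blast+

text \<open>Both shifts are multiples of \<open>N\<close>, since \<open>p * M = q * N\<close>.
  Whether an entry samples its generator inside \<open>S\<close> thus depends only on its column,
  not on the row or the summation index, and a column outside \<open>cols j\<close> has only zero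
  coefficients.\<close>

lemma shift_in_S_iff: "a - n * int N + u * int (p * M) \<in> S \<longleftrightarrow> a \<in> S"
proof -
  have "int (p * M) = int q * int N"
    unfolding qN_eq[symmetric] by simp
  then have "a - n * int N + u * int (p * M) = a + (u * int q - n) * int N"
    by (simp add: algebra_simps)
  then show ?thesis by (simp only: periodic_iff)
qed

lemma not_col:
  assumes "c < p * R" "c \<notin> cols j"
  shows "j + int (c mod p) * int M \<notin> S"
  using assms pos by (auto simp: cols_def K_set_def)

lemma fc_outside:
  assumes "f \<in> ell2_vec S R" "c < p * R" "c \<notin> cols j"
  shows "fc f j c u = 0"
  unfolding fc_def using ell2_vec_outside[OF assms(1)] not_col[OF assms(2,3)]
    shift_in_S_iff[of "j + int (c mod p) * int M" 0 u] by simp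

lemma Z_outside_AE:
  assumes i: "i < q * L" and c: "c < p * R" "c \<notin> cols j"
  shows "AE \<theta> in unit_interval. Z j i c \<theta> = 0"
proof -
  have "zc j i c u = 0" for u
    unfolding zc_def
    by (rule ell2_vec_outside[OF g[OF row_less[OF i]]])
      (use not_col[OF c] in \<open>simp only: shift_in_S_iff simp_thms\<close>)
  then have "zc j i c = (\<lambda>u. 0)" by auto
  then show ?thesis using fourier_series_Z[OF i, of j c] fourier_series_zero_AE by simp
qed

definition kernel_trivial :: "int \<Rightarrow> real \<Rightarrow> bool" where
  "kernel_trivial j \<theta> \<longleftrightarrow> (\<forall>v. (\<forall>i<q * L. (\<Sum>c\<in>cols j. Z j i c \<theta> * v c) = 0) \<longrightarrow> (\<forall>c\<in>cols j. v c = 0))"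

text \<open>The discarded columns have zero coefficients, but their chosen representatives vanish
  only almost everywhere, so the equivalence holds off a null set. This set is a finite union over
  the entries.\<close>

lemma rank_iff_kernel_trivial:
  "AE \<theta> in unit_interval. mat_rank (zak_matrix_sys L M N p q R g j \<theta>) = R * card (K_set S M p j)
    \<longleftrightarrow> kernel_trivial j \<theta>"
proof -
  have "AE \<theta> in unit_interval. \<forall>i\<in>{..<q * L}. \<forall>c\<in>{..<p * R} - cols j. Z j i c \<theta> = 0"
    by (intro AE_finite_allI) (auto intro: Z_outside_AE)
  then show ?thesis
  proof eventually_elim
    case (elim \<theta>)
    have index: "zak_matrix_sys L M N p q R g j \<theta> $$ (i, c) = Z j i c \<theta>" if "i < q * L" "c < p * R" for i c
      using zak_matrix_sys_index[OF that] by (simp add: Z_def)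
    have "mat_rank (zak_matrix_sys L M N p q R g j \<theta>) = card (cols j) \<longleftrightarrow>
      (\<forall>v. (\<forall>i<q * L. (\<Sum>c\<in>cols j. zak_matrix_sys L M N p q R g j \<theta> $$ (i, c) * v c) = 0) \<longrightarrow>
        (\<forall>c\<in>cols j. v c = 0))"
      by (rule mat_rank_eq_card_iff[OF _ cols_subset]) (use elim index in \<open>auto simp: zak_matrix_sys_def\<close>)
    also have "\<dots> \<longleftrightarrow> kernel_trivial j \<theta>"
      unfolding kernel_trivial_def using cols_subset by (auto simp: index subset_iff cong: sum.cong)
    finally show ?case by (simp add: card_cols)
  qed
qed

lemma AE_rank_iff:
  "(AE \<theta> in lborel. \<theta> \<in> {0..<1} \<longrightarrow>
      mat_rank (zak_matrix_sys L M N p q R g j \<theta>) = R * card (K_set S M p j)) \<longleftrightarrow>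
    (AE \<theta> in unit_interval. kernel_trivial j \<theta>)"
  unfolding AE_unit_interval[symmetric]
proof
  show "AE \<theta> in unit_interval. kernel_trivial j \<theta>"
    if "AE \<theta> in unit_interval. mat_rank (zak_matrix_sys L M N p q R g j \<theta>) = R * card (K_set S M p j)"
    using that rank_iff_kernel_trivial[of j] by eventually_elim simp
  show "AE \<theta> in unit_interval. mat_rank (zak_matrix_sys L M N p q R g j \<theta>) = R * card (K_set S M p j)"
    if "AE \<theta> in unit_interval. kernel_trivial j \<theta>"
    using that rank_iff_kernel_trivial[of j] by eventually_elim simp
qed

section \<open>Action of translations and modulations on coefficients\<close>

lemma fc_add: "fc (f + h) j c u = fc f j c u + fc h j c u"
  by (simp add: fc_def)

lemma fc_diff: "fc (f - h) j c u = fc f j c u - fc h j c u"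
  by (simp add: fc_def)

lemma fc_scale: "fc (seq_scale a f) j c u = a * fc f j c u"
  by (simp add: fc_def seq_scale_def)

text \<open>The part \<open>t * q\<close> of the translation amounts to \<open>t\<close> full
  periods \<open>p * M\<close> and shifts the summation index; the remainder below \<open>q\<close>
  is the one built into row \<open>i\<close>.\<close>

lemma fc_translation:
  assumes "i < q * L"
  shows "fc (translation ((t * int q + int (i mod q)) * int N) (g (i div q))) j c u = zc j i c (u - t)"
proof -
  have "int q * int N = int (p * M)"
    unfolding qN_eq[symmetric] by simp
  then have "j + int (c mod p) * int M + u * int (p * M) - (t * int q + int (i mod q)) * int N =
      j + int (c mod p) * int M - int (i mod q) * int N + (u - t) * int (p * M)"
    by (simp add: algebra_simps)
  then show ?thesis by (simp only: fc_def zc_def translation_def)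
qed

lemma exp_modulation_period:
  "exp (2 * of_real pi * \<i> * of_real (real m / real M) * of_int (j + k * int M)) =
    exp (2 * of_real pi * \<i> * of_real (real m / real M) * of_int j)"
proof -
  have "M > 0" using M pos by simp
  then have "2 * of_real pi * \<i> * of_real (real m / real M) * of_int (j + k * int M) =
      2 * of_real pi * \<i> * of_real (real m / real M) * of_int j +
      complex_of_real (2 * of_int (int m * k) * pi) * \<i>"
    by (simp add: field_simps)
  then show ?thesis
    using exp_integer_2pi[of "of_int (int m * k)"] by (simp add: exp_add)
qed

text \<open>All sample points lie in \<open>j + M\<int>\<close>, where the exponential is constant
  with its value at \<open>j\<close>.\<close>

lemma fc_modulation:
  "fc (modulation (real m / real M) f) j c u =
    exp (2 * of_real pi * \<i> * of_real (real m / real M) * of_int j) * fc f j c u"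
proof -
  have "j + int (c mod p) * int M + u * int (p * M) = j + (int (c mod p) + u * int p) * int M"
    by (simp add: algebra_simps)
  then show ?thesis
    unfolding fc_def modulation_def by (simp only: exp_modulation_period)
qed

section \<open>From completeness to a trivial kernel\<close>

text \<open>
  The row space is described by duality as the annihilator of the kernel, a condition that passes to
  pointwise limits.
\<close>

definition in_row_space :: "int \<Rightarrow> (nat \<Rightarrow> int \<Rightarrow> complex) \<Rightarrow> (nat \<Rightarrow> real \<Rightarrow> complex) \<Rightarrow> bool" where
  "in_row_space j h F \<longleftrightarrow> (\<forall>c. fourier_series (fc h j c) (F c)) \<and>
    (AE \<theta> in unit_interval. \<forall>v. (\<forall>i<q * L. (\<Sum>c\<in>cols j. Z j i c \<theta> * v c) = 0) \<longrightarrow>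
      (\<Sum>c\<in>cols j. F c \<theta> * v c) = 0)"

lemma span_in_row_space:
  assumes "h \<in> seqs.span (gabor_system g L M N)"
  shows "\<exists>F. in_row_space j h F"
  using assms
proof (induction rule: seqs.span_induct_alt)
  case base
  have "fc 0 j c = (\<lambda>u. 0)" for c by (auto simp: fc_def)
  then show ?case
    unfolding in_row_space_def
    by (intro exI[of _ "\<lambda>c \<theta>. 0"]) (simp add: fourier_series_zero)
next
  case (step a x y)
  obtain m n l where x: "x = modulation (real m / real M) (translation (n * int N) (g l))" "l < L"
    using step(1) by (auto simp: gabor_system_def)
  obtain G where G: "in_row_space j y G" using step by blast
  \<comment> \<open>Division of \<open>n\<close> by \<open>q\<close> splits the translation: the
    remainder and the generator \<open>l\<close> determine the row, and the quotient
    \<open>t\<close> becomes the frequency of the character.\<close>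
  define i where "i = l * q + nat (n mod int q)"
  define t where "t = n div int q"
  have mod: "nat (n mod int q) < q" using pos by (simp add: nat_less_iff)
  have i: "i < q * L" "i div q = l" "i mod q = nat (n mod int q)"
  proof -
    have "i < Suc l * q" using mod by (simp add: i_def)
    also have "\<dots> \<le> L * q" using x(2) by (intro mult_right_mono) auto
    finally show "i < q * L" by (simp add: mult.commute)
  qed (use mod in \<open>auto simp: i_def\<close>)
  have n: "n = t * int q + int (i mod q)"
    using pos by (simp add: i t_def)
  define w where "w = a * exp (2 * of_real pi * \<i> * of_real (real m / real M) * of_int j)"
  define F where "F c \<theta> = w * (fexp t \<theta> * Z j i c \<theta>) + G c \<theta>" for c \<theta>
  have x': "x = modulation (real m / real M) (translation ((t * int q + int (i mod q)) * int N) (g (i div q)))"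
    unfolding x(1) n[symmetric] i(2) ..
  have "fc (seq_scale a x + y) j c = (\<lambda>u. w * zc j i c (u - t) + fc y j c u)" for c
    unfolding fc_add fc_scale x' fc_modulation fc_translation[OF i(1)] w_def
    by (auto simp: fc_add fc_scale fc_modulation fc_translation[OF i(1)] fun_eq_iff)
  then have "fourier_series (fc (seq_scale a x + y) j c) (F c)" for c
    unfolding F_def[abs_def]
    using G by (auto simp: in_row_space_def
        intro!: fourier_series_add fourier_series_scale fourier_series_shift fourier_series_Z i)
  moreover have "AE \<theta> in unit_interval. \<forall>v. (\<forall>i<q * L. (\<Sum>c\<in>cols j. Z j i c \<theta> * v c) = 0) \<longrightarrow>
      (\<Sum>c\<in>cols j. G c \<theta> * v c) = 0"
    using G by (simp add: in_row_space_def)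
  then have "AE \<theta> in unit_interval. \<forall>v. (\<forall>i<q * L. (\<Sum>c\<in>cols j. Z j i c \<theta> * v c) = 0) \<longrightarrow>
      (\<Sum>c\<in>cols j. F c \<theta> * v c) = 0"
  proof eventually_elim
    case (elim \<theta>)
    show ?case
    proof (intro allI impI)
      fix v assume v: "\<forall>i<q * L. (\<Sum>c\<in>cols j. Z j i c \<theta> * v c) = 0"
      have "(\<Sum>c\<in>cols j. F c \<theta> * v c) =
          w * fexp t \<theta> * (\<Sum>c\<in>cols j. Z j i c \<theta> * v c) + (\<Sum>c\<in>cols j. G c \<theta> * v c)"
        by (simp add: F_def algebra_simps sum.distrib sum_distrib_left)
      then show "(\<Sum>c\<in>cols j. F c \<theta> * v c) = 0" using v elim i(1) by simp
    qed
  qed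
  ultimately show ?case unfolding in_row_space_def by blast
qed

text \<open>Completeness approximates each unit vector at \<open>j + kM\<close>, so its Zak transform, a constant
  unit vector, is a.e. a limit of elements of the row space.\<close>

lemma complete_imp_kernel_trivial:
  assumes complete: "complete_system S R (gabor_system g L M N)"
  shows "AE \<theta> in unit_interval. kernel_trivial j \<theta>"
proof -
  have "AE \<theta> in unit_interval. \<forall>v. (\<forall>i<q * L. (\<Sum>c\<in>cols j. Z j i c \<theta> * v c) = 0) \<longrightarrow> v b = 0"
    if b: "b \<in> cols j" for b
  proof -
    define f :: "nat \<Rightarrow> int \<Rightarrow> complex" where
      "f = (\<lambda>r a. if r = b div p \<and> a = j + int (b mod p) * int M then 1 else 0)"
    have bR: "b div p < R" and bS: "j + int (b mod p) * int M \<in> S"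
      using b pos by (auto simp: cols_def K_set_def less_mult_imp_div_less mult.commute)
    have f: "f \<in> ell2_vec S R"
    proof (rule ell2_vecI)
      show "square_summable (f r)" for r
        unfolding square_summable_def
        by (rule finite_nonzero_values_imp_summable_on, rule finite_subset[of _ "{j + int (b mod p) * int M}"])
          (auto simp: f_def)
    qed (use bR bS in \<open>auto simp: f_def fun_eq_iff\<close>)
    have f_coeff: "fc f j c = (\<lambda>u. (if c = b then 1 else 0) * (if u = 0 then 1 else 0))" for c
    proof
      fix u
      have "c div p = b div p \<and> int (c mod p) * int M + u * int (p * M) = int (b mod p) * int M \<longleftrightarrow>
          c = b \<and> u = 0"
      proof
        assume *: "c div p = b div p \<and> int (c mod p) * int M + u * int (p * M) = int (b mod p) * int M"
        then have "(int (c mod p) + u * int p) * int M = int (b mod p) * int M"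
          by (simp add: algebra_simps)
        then have eq: "int (c mod p) + u * int p = int (b mod p)"
          using M pos by simp
        then have "(int (c mod p) + u * int p) mod int p = int (b mod p) mod int p" by simp
        then have "c mod p = b mod p" by (simp flip: of_nat_mod)
        then show "c = b \<and> u = 0"
          using * eq pos by (metis add_cancel_right_right div_mod_decomp mult_eq_0_iff of_nat_0_eq_iff not_gr_zero)
      qed auto
      then show "fc f j c u = (if c = b then 1 else 0) * (if u = 0 then 1 else 0)"
        by (auto simp: fc_def f_def)
    qed
    have "f \<in> closed_span_in S R (gabor_system g L M N)"
      using complete f by (simp add: complete_system_def)
    \<comment> \<open>The geometric rate makes the squared distances summable, so the Zak transforms
      of the errors tend to zero almost everywhere along the whole sequence.\<close>
    then have "\<exists>h\<in>seqs.span (gabor_system g L M N). ell2_vec_norm R (f - h) < (1/2) ^ n" for n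
      unfolding closed_span_in_def by simp
    then obtain h where h: "\<And>n. h n \<in> seqs.span (gabor_system g L M N)"
      and fh: "\<And>n. ell2_vec_norm R (f - h n) < (1/2) ^ n"
      by metis
    have h_ell2: "h n \<in> ell2_vec S R" for n
      using h span_subset_ell2_vec[OF gabor_system_subset] by blast
    have "\<forall>n. \<exists>F. in_row_space j (h n) F"
      using span_in_row_space[OF h] by blast
    from choice[OF this] obtain F where F: "\<And>n. in_row_space j (h n) (F n)"
      by blast
    have lim: "AE \<theta> in unit_interval. (\<lambda>n. F n c \<theta>) \<longlonglongrightarrow> (if c = b then 1 else 0)" if c: "c < p * R" for c
    proof -
      define D where "D n \<theta> = (if c = b then 1 else 0) * 1 - F n c \<theta>" for n \<theta>
      have D: "fourier_series (fc (f - h n) j c) (D n)" for n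
        unfolding D_def[abs_def] fc_diff f_coeff
        using F[of n] by (intro fourier_series_diff fourier_series_scale fourier_series_delta)
          (auto simp: in_row_space_def)
      have "(\<integral>\<^sup>+\<theta>. ennreal ((cmod (D n \<theta>))\<^sup>2) \<partial>unit_interval) \<le> ennreal ((1/2) ^ n)" for n
      proof -
        have d: "f - h n \<in> ell2_vec S R" by (intro ell2_vec_diff f h_ell2)
        have "c div p < R" using c by (simp add: less_mult_imp_div_less mult.commute)
        then have "sqnorm ((f - h n) (c div p)) \<le> (\<Sum>r<R. sqnorm ((f - h n) r))"
          by (intro member_le_sum) auto
        also have "\<dots> = (ell2_vec_norm R (f - h n))\<^sup>2"
          using ell2_vec_norm_sq[OF d] by simp
        also have "\<dots> \<le> ((1/2) ^ n)\<^sup>2"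
          using fh[of n] ell2_vec_norm_nonneg[OF d] by (intro power_mono) auto
        also have "\<dots> \<le> (1/2) ^ n"
          by (simp add: power2_eq_square mult_left_le power_le_one)
        finally have "sqnorm ((f - h n) (c div p)) \<le> (1/2) ^ n" .
        then have "sqnorm (fc (f - h n) j c) \<le> (1/2) ^ n"
          using square_summable_fc(2)[OF d, of j c] by linarith
        then show ?thesis
          using sqint_fourier_series[OF D[of n] square_summable_fc(1)[OF d]] unfolding sqint_def
          by (simp add: ennreal_leI)
      qed
      then have "AE \<theta> in unit_interval. summable (\<lambda>n. (cmod (D n \<theta>))\<^sup>2)"
        using fourier_series_measurable'[OF D] by (intro AE_summable_of_nn_integral_le) auto
      then show ?thesis
      proof eventually_elim
        case (elim \<theta>)
        then have "(\<lambda>n. sqrt ((cmod (D n \<theta>))\<^sup>2)) \<longlonglongrightarrow> sqrt 0"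
          by (intro tendsto_real_sqrt summable_LIMSEQ_zero)
        then have "(\<lambda>n. D n \<theta>) \<longlonglongrightarrow> 0"
          by (simp add: tendsto_norm_zero_iff)
        then have "(\<lambda>n. (if c = b then 1 else 0) - D n \<theta>) \<longlonglongrightarrow> (if c = b then 1 else 0) - 0"
          by (intro tendsto_diff tendsto_const)
        then show ?case by (simp add: D_def)
      qed
    qed
    have "AE \<theta> in unit_interval. \<forall>c\<in>cols j. (\<lambda>n. F n c \<theta>) \<longlonglongrightarrow> (if c = b then 1 else 0)"
      by (intro AE_finite_allI finite_cols lim) (auto simp: cols_def)
    \<comment> \<open>One null set for each of countably many approximants suffices, because the
      quantifier over \<open>v\<close> stands inside the a.e. statement; the kernel may then be
      examined at a fixed \<theta>.\<close>
    moreover have "AE \<theta> in unit_interval. \<forall>n. \<forall>v. (\<forall>i<q * L. (\<Sum>c\<in>cols j. Z j i c \<theta> * v c) = 0) \<longrightarrow>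
        (\<Sum>c\<in>cols j. F n c \<theta> * v c) = 0"
      using F by (simp add: AE_all_countable in_row_space_def)
    ultimately show ?thesis
    proof eventually_elim
      case (elim \<theta>)
      show ?case
      proof (intro allI impI)
        fix v assume "\<forall>i<q * L. (\<Sum>c\<in>cols j. Z j i c \<theta> * v c) = 0"
        then have 0: "(\<Sum>c\<in>cols j. F n c \<theta> * v c) = 0" for n using elim(2) by blast
        have "(\<lambda>n. \<Sum>c\<in>cols j. F n c \<theta> * v c) \<longlonglongrightarrow> (\<Sum>c\<in>cols j. (if c = b then 1 else 0) * v c)"
          using elim(1) by (intro tendsto_sum tendsto_mult tendsto_const) auto
        then have "(\<Sum>c\<in>cols j. (if c = b then 1 else 0) * v c) = 0"
          unfolding 0 by (simp add: LIMSEQ_const_iff)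
        then show "v b = 0"
          using b finite_cols by (simp add: if_distrib[of "\<lambda>x. x * _"] cong: if_cong)
      qed
    qed
  qed
  then have "AE \<theta> in unit_interval. \<forall>b\<in>cols j. \<forall>v. (\<forall>i<q * L. (\<Sum>c\<in>cols j. Z j i c \<theta> * v c) = 0) \<longrightarrow> v b = 0"
    by (intro AE_finite_allI finite_cols)
  then show ?thesis
    by eventually_elim (auto simp: kernel_trivial_def)
qed

section \<open>From a trivial kernel to completeness\<close>

text \<open>Fourier inversion on the group of residues modulo \<open>M\<close>: orthogonality to all modulations
  splits over the residue classes.\<close>

lemma orthogonal_residue_class:
  assumes w: "w \<in> ell2_vec S R" and h: "h \<in> ell2_vec S R"
    and orth: "\<And>m. m < M \<Longrightarrow> ell2_vec_inner R w (modulation (real m / real M) h) = 0"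
  shows "(\<Sum>c<p * R. inprod (fc w j c) (fc h j c)) = 0"
proof -
  define e where "e m a = exp (2 * of_real pi * \<i> * of_real (real m / real M) * of_int a)" for m :: nat and a :: int
  have Mpos: "M > 0" using M pos by simp
  have cnj_e: "cnj (e m a) = e m (- a)" for m a
    by (simp add: e_def exp_cnj)
  have e_add: "e m j * e m (- a) = e m (j - a)" for m a
    by (simp add: e_def algebra_simps diff_divide_distrib flip: exp_add)
  let ?P = "\<lambda>r a. w r a * cnj (h r a)"
  have sumP: "?P r summable_on UNIV" for r
    by (rule square_summable_prod[OF ell2_vec_comp[OF w] ell2_vec_comp[OF h]])
  have sum_e: "(\<lambda>a. e m (j - a) * ?P r a) summable_on UNIV" for m r
  proof -
    have "(\<lambda>a. cmod (e m (j - a) * ?P r a)) = (\<lambda>a. cmod (?P r a))"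
      by (simp add: norm_mult e_def norm_exp_eq_Re)
    then show ?thesis
      using sumP[of r] by (simp add: summable_on_iff_abs_summable_on_complex)
  qed
  have 1: "(\<Sum>r<R. \<Sum>\<^sub>\<infinity>a. e m (j - a) * ?P r a) = 0" if "m < M" for m
  proof -
    have "(\<Sum>r<R. \<Sum>\<^sub>\<infinity>a. e m (j - a) * ?P r a) =
        e m j * (\<Sum>r<R. \<Sum>\<^sub>\<infinity>a. w r a * cnj (e m a * h r a))"
      unfolding sum_distrib_left infsum_cmult_right'[symmetric]
      by (intro sum.cong infsum_cong refl) (simp add: cnj_e algebra_simps flip: e_add)
    also have "(\<Sum>r<R. \<Sum>\<^sub>\<infinity>a. w r a * cnj (e m a * h r a)) = ell2_vec_inner R w (modulation (real m / real M) h)"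
      by (simp add: ell2_vec_inner_def ell2_inner_def modulation_def e_def)
    finally show ?thesis using orth[OF that] by simp
  qed
  \<comment> \<open>Each identity has been multiplied by \<open>e m j\<close>, so that summation
    over \<open>m\<close> produces \<open>M\<close> times the indicator of the residue class of
    \<open>j\<close>.\<close>
  have "(\<Sum>r<R. \<Sum>\<^sub>\<infinity>a. (\<Sum>m<M. e m (j - a)) * ?P r a) = (\<Sum>r<R. \<Sum>m<M. \<Sum>\<^sub>\<infinity>a. e m (j - a) * ?P r a)"
    unfolding sum_distrib_right
    by (intro sum.cong refl infsum_finite_sum sum_e finite_lessThan)
  also have "\<dots> = (\<Sum>m<M. \<Sum>r<R. \<Sum>\<^sub>\<infinity>a. e m (j - a) * ?P r a)"
    by (rule sum.swap)
  also have "\<dots> = 0"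
    using 1 by simp
  finally have 2: "(\<Sum>r<R. \<Sum>\<^sub>\<infinity>a. (if int M dvd j - a then of_nat M else 0) * ?P r a) = 0"
    unfolding e_def sum_roots_of_unity[OF Mpos] .
  have "(\<Sum>\<^sub>\<infinity>a. (if int M dvd j - a then of_nat M else 0) * ?P r a) =
      of_nat M * (\<Sum>k<p. \<Sum>\<^sub>\<infinity>u. ?P r (j + int k * int M + u * int (p * M)))" for r
  proof -
    \<comment> \<open>The class of \<open>j\<close> modulo \<open>M\<close> splits into
      \<open>p\<close> progressions of step \<open>p * M\<close>, one for each residue
      \<open>k\<close> of a column.\<close>
    define B where "B k = range (\<lambda>u. j + int k * int M + u * int (p * M))" for k :: nat
    have B: "a \<in> (\<Union>k<p. B k) \<longleftrightarrow> int M dvd j - a" for a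
    proof
      assume "int M dvd j - a"
      then have "int M dvd a - j" by (simp add: dvd_diff_commute)
      then obtain b where b: "a - j = int M * b" by (elim dvdE)
      define k where "k = nat (b mod int p)"
      have k: "int k = b mod int p" "k < p"
        using pos by (auto simp: k_def nat_less_iff)
      define u where "u = b div int p"
      have "b = int k + u * int p" using k by (simp add: u_def)
      with b have "a = j + int M * (int k + u * int p)" by simp
      also have "\<dots> = j + int k * int M + u * int (p * M)" by (simp add: algebra_simps)
      finally show "a \<in> (\<Union>k<p. B k)" unfolding B_def using k(2) by blast
    next
      assume "a \<in> (\<Union>k<p. B k)"
      then obtain k u where "a = j + int k * int M + u * int (p * M)" by (auto simp: B_def)
      then have "j - a = int M * (- int k - u * int p)" by (simp add: algebra_simps)
      then show "int M dvd j - a" by simp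
    qed
    have disj: "B k \<inter> B k' = {}" if kk: "k < p" "k' < p" "k \<noteq> k'" for k k'
    proof (rule ccontr)
      assume "B k \<inter> B k' \<noteq> {}"
      then obtain u u' where "j + int k * int M + u * int (p * M) = j + int k' * int M + u' * int (p * M)"
        by (auto simp: B_def)
      then have "(int k + u * int p) * int M = (int k' + u' * int p) * int M"
        by (simp add: algebra_simps)
      then have "int k + u * int p = int k' + u' * int p" using Mpos by simp
      then have "(int k + u * int p) mod int p = (int k' + u' * int p) mod int p" by simp
      then show False using kk by simp
    qed
    have "(\<Sum>\<^sub>\<infinity>a. (if int M dvd j - a then of_nat M else 0) * ?P r a) = (\<Sum>\<^sub>\<infinity>a\<in>(\<Union>k<p. B k). of_nat M * ?P r a)"
      by (rule infsum_cong_neutral) (auto simp: B[simplified])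
    also have "\<dots> = of_nat M * (\<Sum>\<^sub>\<infinity>a\<in>(\<Union>k<p. B k). ?P r a)"
      by (rule infsum_cmult_right')
    also have "(\<Sum>\<^sub>\<infinity>a\<in>(\<Union>k<p. B k). ?P r a) = (\<Sum>k<p. \<Sum>\<^sub>\<infinity>a\<in>B k. ?P r a)"
      using disj by (intro sum_infsum[symmetric] summable_on_subset_banach[OF sumP]) auto
    also have "\<dots> = (\<Sum>k<p. \<Sum>\<^sub>\<infinity>u. ?P r (j + int k * int M + u * int (p * M)))"
      unfolding B_def by (subst infsum_reindex[OF inj_period]) (simp add: o_def)
    finally show ?thesis .
  qed
  then have "of_nat M * (\<Sum>r<R. \<Sum>k<p. \<Sum>\<^sub>\<infinity>u. ?P r (j + int k * int M + u * int (p * M))) = 0"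
    using 2 by (simp add: sum_distrib_left)
  then have "(\<Sum>r<R. \<Sum>k<p. \<Sum>\<^sub>\<infinity>u. ?P r (j + int k * int M + u * int (p * M))) = 0"
    using Mpos by simp
  then show ?thesis
    using sum_div_mod[OF pos(1), where R = R and
        f = "\<lambda>r k. \<Sum>\<^sub>\<infinity>u. ?P r (j + int k * int M + u * int (p * M))"]
    by (simp add: inprod_def fc_def)
qed

lemma orthogonal_imp_zero_class:
  assumes w: "w \<in> ell2_vec S R"
    and orth: "\<And>x. x \<in> gabor_system g L M N \<Longrightarrow> ell2_vec_inner R w x = 0"
    and ker: "AE \<theta> in unit_interval. kernel_trivial j \<theta>"
    and c: "c < p * R"
  shows "fc w j c u = 0"
proof -
  have "\<forall>c. \<exists>F. fourier_series (fc w j c) F"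
  proof
    show "\<exists>F. fourier_series (fc w j c) F" for c
      by (rule fourier_series_exists[OF square_summable_fc(1)[OF w, of j c]]) blast
  qed
  from choice[OF this] obtain W where W: "\<And>c. fourier_series (fc w j c) (W c)"
    by blast
  have "AE \<theta> in unit_interval. (\<Sum>c<p * R. W c \<theta> * cnj (Z j i c \<theta>)) = 0" if i: "i < q * L" for i
  proof (rule zero_Fourier_coefficients_AE_0)
    have int: "has_bochner_integral unit_interval (\<lambda>\<theta>. W c \<theta> * cnj (fexp t \<theta> * Z j i c \<theta>))
        (inprod (fc w j c) (\<lambda>u. zc j i c (u - t)))" for t c
      by (intro fourier_series_inprod W fourier_series_shift fourier_series_Z i
          square_summable_fc(1)[OF w] square_summable_reindex(1)[OF square_summable_zc[OF i]])
        (simp add: inj_on_def)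
    have sum: "has_bochner_integral unit_interval
        (\<lambda>\<theta>. (\<Sum>c<p * R. W c \<theta> * cnj (Z j i c \<theta>)) * fexp (- t) \<theta>)
        (\<Sum>c<p * R. inprod (fc w j c) (\<lambda>u. zc j i c (u - t)))" for t
    proof -
      have "W c \<theta> * cnj (Z j i c \<theta>) * fexp (- t) \<theta> = W c \<theta> * cnj (fexp t \<theta> * Z j i c \<theta>)" for c \<theta>
        by (simp add: cnj_fexp)
      then show ?thesis
        unfolding sum_distrib_right by (simp only:) (intro has_bochner_integral_sum int)
    qed
    show "integrable unit_interval (\<lambda>\<theta>. \<Sum>c<p * R. W c \<theta> * cnj (Z j i c \<theta>))"
      using integrable.intros[OF sum[of 0]] by simp
    fix t
    \<comment> \<open>Conjugation of the matrix entry reverses the frequency, so the integral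
      against \<open>fexp t\<close> pairs \<open>w\<close> with the translate whose quotient is
      \<open>- t\<close>.\<close>
    let ?h = "translation ((- t * int q + int (i mod q)) * int N) (g (i div q))"
    have h: "?h \<in> ell2_vec S R"
      by (intro translation_ell2_vec g row_less i)
    have "(\<Sum>c<p * R. inprod (fc w j c) (fc ?h j c)) = 0"
      by (rule orthogonal_residue_class[OF w h], rule orth)
        (use row_less[OF i] in \<open>auto simp: gabor_system_def\<close>)
    moreover have "fc ?h j c = (\<lambda>u. zc j i c (u - (- t)))" for c
      using fc_translation[OF i, of "- t"] by (auto simp: fun_eq_iff)
    ultimately show "(\<integral>\<theta>. (\<Sum>c<p * R. W c \<theta> * cnj (Z j i c \<theta>)) * fexp t \<theta> \<partial>unit_interval) = 0"
      using has_bochner_integral_integral_eq[OF sum[of "- t"]] by simp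
  qed
  then have "AE \<theta> in unit_interval. \<forall>i\<in>{..<q * L}. (\<Sum>c<p * R. W c \<theta> * cnj (Z j i c \<theta>)) = 0"
    by (intro AE_finite_allI) auto
  moreover have "AE \<theta> in unit_interval. \<forall>c\<in>{..<p * R} - cols j. W c \<theta> = 0"
  proof (intro AE_finite_allI)
    fix c assume "c \<in> {..<p * R} - cols j"
    then have "fc w j c = (\<lambda>u. 0)"
      using fc_outside[OF w] by auto
    then show "AE \<theta> in unit_interval. W c \<theta> = 0"
      using W[of c] fourier_series_zero_AE by simp
  qed simp
  ultimately have "AE \<theta> in unit_interval. W c \<theta> = 0"
    using ker
  proof eventually_elim
    case (elim \<theta>)
    have "(\<Sum>c\<in>cols j. Z j i c \<theta> * cnj (W c \<theta>)) = 0" if "i < q * L" for i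
    proof -
      have "(\<Sum>c\<in>cols j. Z j i c \<theta> * cnj (W c \<theta>)) = (\<Sum>c<p * R. Z j i c \<theta> * cnj (W c \<theta>))"
        using elim(2) cols_subset by (intro sum.mono_neutral_left) auto
      also have "\<dots> = cnj (\<Sum>c<p * R. W c \<theta> * cnj (Z j i c \<theta>))"
        by (simp add: mult.commute)
      also have "\<dots> = 0" using elim(1) that by simp
      finally show ?thesis .
    qed
    then have "\<forall>c\<in>cols j. cnj (W c \<theta>) = 0"
      using elim(3)[unfolded kernel_trivial_def, THEN spec[of _ "\<lambda>c. cnj (W c \<theta>)"]] by blast
    then show ?case using elim(2) c by (cases "c \<in> cols j") auto
  qed
  then show ?thesis
    by (rule fourier_series_coeff_eq_0[OF W square_summable_fc(1)[OF w]])
qed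

text \<open>Moving the translation to the other argument sends a system element to another one:
  translation and modulation commute up to a constant of modulus one, and the translation index
  changes from \<open>k\<close> to \<open>k + n\<close>.\<close>

lemma orthogonal_translation:
  assumes orth: "\<And>x. x \<in> gabor_system g L M N \<Longrightarrow> ell2_vec_inner R w x = 0"
    and x: "x \<in> gabor_system g L M N"
  shows "ell2_vec_inner R (translation (- n * int N) w) x = 0"
proof -
  obtain m k l where x: "x = modulation (real m / real M) (translation (k * int N) (g l))" "m < M" "l < L"
    using x by (auto simp: gabor_system_def)
  define e where "e a = exp (2 * of_real pi * \<i> * of_real (real m / real M) * of_int a)" for a :: int
  have e_diff: "e (a - n * int N) = e a * e (- n * int N)" for a
    by (simp add: e_def algebra_simps diff_divide_distrib flip: exp_add)
  let ?y = "modulation (real m / real M) (translation ((k + n) * int N) (g l))"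
  have "ell2_inner (translation (- n * int N) w r) (x r) = cnj (e (- n * int N)) * ell2_inner (w r) (?y r)" for r
  proof -
    have "ell2_inner (translation (- n * int N) w r) (x r) =
        (\<Sum>\<^sub>\<infinity>a. w r (a + n * int N) * cnj (e a * g l r (a - k * int N)))"
      by (simp add: ell2_inner_def x modulation_def translation_def e_def)
    also have "\<dots> = (\<Sum>\<^sub>\<infinity>a. w r a * cnj (e (a - n * int N) * g l r (a - n * int N - k * int N)))"
      by (rule infsum_reindex_bij_witness[of _ "\<lambda>a. a - n * int N" "\<lambda>a. a + n * int N"]) auto
    also have "\<dots> = (\<Sum>\<^sub>\<infinity>a. cnj (e (- n * int N)) * (w r a * cnj (e a * g l r (a - (k + n) * int N))))"
      unfolding e_diff by (intro infsum_cong) (simp add: algebra_simps)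
    also have "\<dots> = cnj (e (- n * int N)) * ell2_inner (w r) (?y r)"
      by (simp add: infsum_cmult_right' ell2_inner_def modulation_def translation_def e_def)
    finally show ?thesis .
  qed
  then have "ell2_vec_inner R (translation (- n * int N) w) x = cnj (e (- n * int N)) * ell2_vec_inner R w ?y"
    by (simp add: ell2_vec_inner_def sum_distrib_left)
  also have "ell2_vec_inner R w ?y = 0"
    using x(2,3) by (intro orth) (auto simp: gabor_system_def)
  finally show ?thesis by simp
qed

lemma kernel_trivial_imp_complete:
  assumes ker: "\<And>j. j < s \<Longrightarrow> AE \<theta> in unit_interval. kernel_trivial (int j) \<theta>"
  shows "complete_system S R (gabor_system g L M N)"
  unfolding complete_system_def
proof (intro conjI gabor_system_subset closed_span_eq_ell2_vec)
  fix w assume w: "w \<in> ell2_vec S R"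
    and orth: "\<And>x. x \<in> gabor_system g L M N \<Longrightarrow> ell2_vec_inner R w x = 0"
  have "w r a = 0" if r: "r < R" for r a
  proof -
    define j where "j = nat (a mod int s)"
    define b where "b = a div int s"
    have j: "int j = a mod int s" "j < s"
      using pos by (auto simp: j_def nat_less_iff)
    have "coprime (int q) (int p)"
      using coprime by (simp add: coprime_commute)
    \<comment> \<open>Multiplied by \<open>s * b\<close>, the Bezout identity writes
      \<open>s * b\<close> as \<open>b * x * M + b * y * N\<close>. Dividing \<open>b * x\<close> by
      \<open>p\<close> gives the column residue \<open>k\<close> and the summation index
      \<open>u\<close>, while the multiple of \<open>N\<close> is absorbed by translating
      \<open>w\<close>.\<close>
    then obtain x y where xy: "x * int q + y * int p = 1"
      using bezout_int[of "int q" "int p"] by auto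
    define k where "k = nat ((b * x) mod int p)"
    define u where "u = (b * x) div int p"
    have k: "int k = (b * x) mod int p" "k < p"
      using pos by (auto simp: k_def nat_less_iff)
    have "a = int j + int s * b" by (simp add: j b_def)
    also have "int s * b = int s * (b * (x * int q + y * int p))" by (simp add: xy)
    also have "\<dots> = b * x * int M + b * y * int N"
      by (simp add: M N algebra_simps)
    also have "b * x = int k + u * int p" by (simp add: k u_def)
    finally have a: "a = int j + int k * int M + u * int (p * M) + b * y * int N"
      by (simp add: algebra_simps)
    define w' where "w' = translation (- (b * y) * int N) w"
    have w': "w' \<in> ell2_vec S R"
      unfolding w'_def by (rule translation_ell2_vec[OF w])
    have "fc w' (int j) (r * p + k) u = 0"
    proof (rule orthogonal_imp_zero_class[OF w' _ ker[OF j(2)]])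
      show "ell2_vec_inner R w' x = 0" if "x \<in> gabor_system g L M N" for x
        unfolding w'_def by (rule orthogonal_translation[OF orth that])
      have "r * p + k < Suc r * p" using k(2) by simp
      also have "\<dots> \<le> R * p" using r by (intro mult_right_mono) auto
      finally show "r * p + k < p * R" by (simp add: mult.commute)
    qed
    then show ?thesis
      using k(2) by (simp add: fc_def w'_def translation_def a)
  qed
  then show "w = 0"
    using ell2_vec_outside[OF w] by (metis (no_types, opaque_lifting) ext not_le zero_fun_def)
qed

end

theorem theorem3p6:
  fixes L M N R p q :: nat and S :: "int set" and g :: "nat \<Rightarrow> nat \<Rightarrow> int \<Rightarrow> complex"
  assumes "L \<ge> 1" and "M \<ge> 1" and "N \<ge> 1" and "R \<ge> 1"
    and "p \<ge> 1" and "q \<ge> 1" and "coprime p q" and "real N / real M = real p / real q"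
    and "periodic_set N S"
    and "\<forall>l<L. g l \<in> ell2_vec S R"
  shows "complete_system S R (gabor_system g L M N) \<longleftrightarrow>
    (\<forall>j<M div q. AE \<theta> in lborel. \<theta> \<in> {0..<1} \<longrightarrow>
        mat_rank (zak_matrix_sys L M N p q R g (int j) \<theta>) = R * card (K_set S M p (int j)))"
proof -
  define s where "s = M div q"
  have "real N * real q = real p * real M"
    using assms(2,6,8) by (simp add: field_simps)
  then have NqpM: "N * q = p * M"
    by (metis of_nat_eq_iff of_nat_mult)
  \<comment> \<open>Coprimality turns \<open>N * q = p * M\<close> into divisibility of
    \<open>M\<close> by \<open>q\<close>, so \<open>M div q\<close> is exact and
    \<open>N = p * s\<close> follows by cancelling \<open>q\<close>.\<close>
  then have "q dvd p * M"
    by (metis dvd_triv_right)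
  then have "q dvd M"
    using assms(7) by (simp add: coprime_commute coprime_dvd_mult_right_iff)
  then have M: "M = q * s"
    by (simp add: s_def)
  have N: "N = p * s"
    using NqpM assms(6) unfolding M by simp
  have "s > 0"
    using M assms(2) by (intro Nat.gr0I) simp
  then interpret gabor_setting L M N R p q s S g
    using M N assms by unfold_locales auto
  \<comment> \<open>Completeness gives a trivial kernel for every integer \<open>j\<close>, whereas
    the converse asks for it only at the representatives below \<open>s\<close>.\<close>
  show ?thesis
    unfolding AE_rank_iff s_def[symmetric]
    using complete_imp_kernel_trivial kernel_trivial_imp_complete by blast
qed

end
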